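(* Let $T>0$, let $u_0\in\mathcal M$ be a Gaussian wave packet with $\|u_0\|_{L^2}=1$, let $\psi$ be the solution of $i\varepsilon\partial_t\psi(t)=H(t)\psi(t)$, $\psi(0)=u_0$, and let $u(t)\in\mathcal M$ be the solution of $i\varepsilon\partial_tu(t)=P_{u(t)}(H(t)u(t))$, $u(0)=u_0$. Let $\rho>0$ be a lower bound for the smallest eigenvalue of $\mathrm{Im}\,\mathcal C(t)$, $t\in[0,T]$, where $\mathcal C(t)$ is the width matrix of $u(t)$. Then $$\|\psi(t)-u(t)\|_{L^2}\le t\,c\,\sqrt{\varepsilon},\qquad t\in[0,T],$$ with a constant $c$ which depends on $\rho$, on ($\varepsilon$-independent) bounds on the parameters $q,p,\mathcal C,\zeta$ of $u$ on $[0,T]$, and on the potentials, but is independent of $\varepsilon$ and $t$.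
   Context: Potentials. $A=(A_j)_{j=1}^d:\mathbb R\times\mathbb R^d\to\mathbb R^d$ and $V:\mathbb R\times\mathbb R^d\to\mathbb R$ are functions of $(t,x)$, and $\widetilde V:=\frac12|A|^2+V$. Standing assumption: $A$ and $\widetilde V$ are infinitely often differentiable; $\widetilde V$ is subquadratic in $x$ (i.e. $\nabla^k\widetilde V$ is bounded for all $k\ge2$); $A$ is sublinear in $x$ (i.e. $\nabla^kA$ is bounded for all $k\ge1$) and $\mathrm{div}\,A=0$. Here $\nabla$ denotes spatial derivatives. Hamiltonian. For a semiclassical parameter $\varepsilon\in(0,1]$, $H(t)=\frac12(i\varepsilon\nabla_x+A(t,x))^2+V(t,x)=-\frac{\varepsilon^2}{2}\Delta+i\varepsilon A(t)\cdot\nabla+\widetilde V(t)$. The solution of $i\varepsilon\partial_t\psi=H(t)\psi$ is $\psi(t)=U(t,0)\psi(0)$, where $(U(t,s))_{t,s\in\mathbb R}$ is the unitary evolution family on $L^2(\mathbb R^d)$ generated by $H(t)$ (known to exist, e.g., if in addition $\partial_tA$ is sublinear). Gaussian wave packets. $\mathcal M$ is the set of functions $g(x)=\exp\big(\frac{i}{\varepsilon}(\frac12(x-q)^T\mathcal C(x-q)+(x-q)^Tp+\zeta)\big)$ with $q,p\in\mathbb R^d$, $\mathcal C=\mathcal C^T\in\mathbb C^{d\times d}$ (the width matrix) with positive definite imaginary part, $\zeta\in\mathbb C$. The tangent space at $u\in\mathcal M$ is $\mathcal T_u\mathcal M=\{\varphi u:\varphi$ a $d$-variate complex polynomial of degree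 at most $2\}$, and $P_u:L^2(\mathbb R^d)\to\mathcal T_u\mathcal M$ is the orthogonal projection. The parameters of the variational solution $u$ are known to be bounded on $[0,T]$ independently of $\varepsilon$. *)

theory Defs
  imports "HOL-Analysis.Analysis"
begin

text \<open>Elements of \<open>L\<^sup>2\<close> are represented by functions; equality in \<open>L\<^sup>2\<close> is equality almost
  everywhere.\<close>

definition L2 :: "('a::euclidean_space \<Rightarrow> complex) set" where
  "L2 = {f. f \<in> borel_measurable lborel \<and> integrable lborel (\<lambda>x. (cmod (f x))\<^sup>2)}"

definition L2_inner :: "('a::euclidean_space \<Rightarrow> complex) \<Rightarrow> ('a \<Rightarrow> complex) \<Rightarrow> complex" where
  "L2_inner f g = (LINT x|lborel. cnj (f x) * g x)"

definition L2_norm :: "('a::euclidean_space \<Rightarrow> complex) \<Rightarrow> real" where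
  "L2_norm f = sqrt (LINT x|lborel. (cmod (f x))\<^sup>2)"

definition has_L2_derivative ::
  "(real \<Rightarrow> 'a::euclidean_space \<Rightarrow> complex) \<Rightarrow> ('a \<Rightarrow> complex) \<Rightarrow> real \<Rightarrow> real set \<Rightarrow> bool" where
  "has_L2_derivative u du t S \<longleftrightarrow> du \<in> L2 \<and> (\<forall>s\<in>S. u s \<in> L2) \<and>
     ((\<lambda>s. L2_norm (\<lambda>x. (u s x - u t x) / of_real (s - t) - du x)) \<longlongrightarrow> 0) (at t within S)"

definition L2_unitary ::
  "(('a::euclidean_space \<Rightarrow> complex) \<Rightarrow> ('a \<Rightarrow> complex)) \<Rightarrow> bool" where
  "L2_unitary W \<longleftrightarrow>
     (\<forall>f\<in>L2. W f \<in> L2) \<and>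
     (\<forall>f\<in>L2. \<forall>g\<in>L2. \<forall>a b. AE x in lborel.
        W (\<lambda>y. a * f y + b * g y) x = a * W f x + b * W g x) \<and>
     (\<forall>f\<in>L2. \<forall>g\<in>L2. L2_inner (W f) (W g) = L2_inner f g) \<and>
     (\<forall>g\<in>L2. \<exists>f\<in>L2. AE x in lborel. W f x = g x)"

text \<open>The projection is determined up to null sets, hence the choice operator.\<close>

definition L2_proj ::
  "('a::euclidean_space \<Rightarrow> complex) set \<Rightarrow> ('a \<Rightarrow> complex) \<Rightarrow> 'a \<Rightarrow> complex" where
  "L2_proj S f = (SOME g. g \<in> S \<and> (\<forall>h\<in>S. L2_inner h (\<lambda>x. f x - g x) = 0))"

primrec iter_deriv ::
  "'a list \<Rightarrow> ('a::euclidean_space \<Rightarrow> 'b::real_normed_vector) \<Rightarrow> 'a \<Rightarrow> 'b" where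
  "iter_deriv [] f = f"
| "iter_deriv (v # vs) f = (\<lambda>x. frechet_derivative (iter_deriv vs f) (at x) v)"

definition smooth :: "('a::euclidean_space \<Rightarrow> 'b::real_normed_vector) \<Rightarrow> bool" where
  "smooth f \<longleftrightarrow> (\<forall>vs x. iter_deriv vs f differentiable (at x))"

definition schwartz :: "('a::euclidean_space \<Rightarrow> complex) \<Rightarrow> bool" where
  "schwartz f \<longleftrightarrow> smooth f \<and>
     (\<forall>k vs. \<exists>B. \<forall>x. norm x ^ k * cmod (iter_deriv vs f x) \<le> B)"

text \<open>Boundedness, over all \<open>(t, x)\<close>, of the tensor of all \<open>k\<close>-th order spatial partial derivatives.\<close>

definition spatial_deriv_bounded ::
  "nat \<Rightarrow> (real \<Rightarrow> 'a::euclidean_space \<Rightarrow> 'b::real_normed_vector) \<Rightarrow> bool" where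
  "spatial_deriv_bounded k F \<longleftrightarrow>
     (\<exists>B. \<forall>t x vs. length vs = k \<and> set vs \<subseteq> Basis \<longrightarrow> norm (iter_deriv vs (F t) x) \<le> B)"

definition partial ::
  "'n::finite \<Rightarrow> (real^'n \<Rightarrow> 'b::real_normed_vector) \<Rightarrow> real^'n \<Rightarrow> 'b" where
  "partial j f x = frechet_derivative f (at x) (axis j 1)"

definition eff_potential ::
  "(real \<Rightarrow> real^'n \<Rightarrow> real^'n) \<Rightarrow> (real \<Rightarrow> real^'n \<Rightarrow> real) \<Rightarrow> real \<Rightarrow> real^'n::finite \<Rightarrow> real" where
  "eff_potential A V t x = (norm (A t x))\<^sup>2 / 2 + V t x"

definition admissible_potentials ::
  "(real \<Rightarrow> real^'n \<Rightarrow> real^'n) \<Rightarrow> (real \<Rightarrow> real^'n::finite \<Rightarrow> real) \<Rightarrow> bool" where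
  "admissible_potentials A V \<longleftrightarrow>
     smooth (\<lambda>(t, x). A t x) \<and>
     smooth (\<lambda>(t, x). eff_potential A V t x) \<and>
     (\<forall>k\<ge>2. spatial_deriv_bounded k (eff_potential A V)) \<and>
     (\<forall>k\<ge>1. spatial_deriv_bounded k A) \<and>
     (\<forall>t x. (\<Sum>j\<in>UNIV. partial j (A t) x $ j) = 0)"

definition momentum ::
  "real \<Rightarrow> (real \<Rightarrow> real^'n \<Rightarrow> real^'n) \<Rightarrow> real \<Rightarrow> 'n::finite \<Rightarrow>
   (real^'n \<Rightarrow> complex) \<Rightarrow> real^'n \<Rightarrow> complex" where
  "momentum \<epsilon> A t j f x = \<i> * of_real \<epsilon> * partial j f x + of_real (A t x $ j) * f x"

definition hamiltonian ::
  "real \<Rightarrow> (real \<Rightarrow> real^'n \<Rightarrow> real^'n) \<Rightarrow> (real \<Rightarrow> real^'n \<Rightarrow> real) \<Rightarrow> real \<Rightarrow>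
   (real^'n::finite \<Rightarrow> complex) \<Rightarrow> real^'n \<Rightarrow> complex" where
  "hamiltonian \<epsilon> A V t f x =
     (1 / 2) * (\<Sum>j\<in>UNIV. momentum \<epsilon> A t j (momentum \<epsilon> A t j f) x) + of_real (V t x) * f x"

text \<open>\<open>H(t) f = g\<close> for \<open>f, g \<in> L\<^sup>2\<close> in the sense of tempered distributions, i.e. \<open>H(t)\<close> as the
  adjoint of the Hamiltonian on Schwartz functions.\<close>

definition weak_hamiltonian ::
  "real \<Rightarrow> (real \<Rightarrow> real^'n \<Rightarrow> real^'n) \<Rightarrow> (real \<Rightarrow> real^'n \<Rightarrow> real) \<Rightarrow> real \<Rightarrow>
   (real^'n::finite \<Rightarrow> complex) \<Rightarrow> (real^'n \<Rightarrow> complex) \<Rightarrow> bool" where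
  "weak_hamiltonian \<epsilon> A V t f g \<longleftrightarrow> f \<in> L2 \<and> g \<in> L2 \<and>
     (\<forall>\<phi>. schwartz \<phi> \<longrightarrow> L2_inner (hamiltonian \<epsilon> A V t \<phi>) f = L2_inner \<phi> g)"

definition unitary_evolution_family ::
  "(real \<Rightarrow> real \<Rightarrow> ('a::euclidean_space \<Rightarrow> complex) \<Rightarrow> 'a \<Rightarrow> complex) \<Rightarrow> bool" where
  "unitary_evolution_family U \<longleftrightarrow>
     (\<forall>t s. L2_unitary (U t s)) \<and>
     (\<forall>s. \<forall>f\<in>L2. AE x in lborel. U s s f x = f x) \<and>
     (\<forall>t r s. \<forall>f\<in>L2. AE x in lborel. U t r (U r s f) x = U t s f x) \<and>
     (\<forall>f\<in>L2. \<forall>t s. ((\<lambda>(t', s'). L2_norm (\<lambda>x. U t' s' f x - U t s f x)) \<longlongrightarrow> 0) (at (t, s)))"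

text \<open>\<open>U\<close> is generated by \<open>H\<close>: for Schwartz data \<open>f\<close>, in \<open>L\<^sup>2\<close>,
  \<open>i\<epsilon> \<partial>\<^sub>t U(t,s) f = H(t) U(t,s) f\<close> and \<open>i\<epsilon> \<partial>\<^sub>s U(t,s) f = - U(t,s) H(s) f\<close>. As \<open>U(t,s) f\<close> need not
  be classically differentiable, \<open>H(t)\<close> is applied weakly in the first equation.\<close>

definition generated_by_hamiltonian ::
  "real \<Rightarrow> (real \<Rightarrow> real^'n \<Rightarrow> real^'n) \<Rightarrow> (real \<Rightarrow> real^'n \<Rightarrow> real) \<Rightarrow>
   (real \<Rightarrow> real \<Rightarrow> (real^'n::finite \<Rightarrow> complex) \<Rightarrow> real^'n \<Rightarrow> complex) \<Rightarrow> bool" where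
  "generated_by_hamiltonian \<epsilon> A V U \<longleftrightarrow>
     (\<forall>f t s. schwartz f \<longrightarrow>
        (\<exists>du. has_L2_derivative (\<lambda>t'. U t' s f) du t UNIV \<and>
              weak_hamiltonian \<epsilon> A V t (U t s f) (\<lambda>x. \<i> * of_real \<epsilon> * du x)) \<and>
        (\<exists>du. has_L2_derivative (\<lambda>s'. U t s' f) du s UNIV \<and>
              (AE x in lborel. \<i> * of_real \<epsilon> * du x = - U t s (hamiltonian \<epsilon> A V s f) x)))"

definition Im_matrix :: "complex^'n^'n \<Rightarrow> real^'n^'n" where
  "Im_matrix C = (\<chi> i j. Im (C $ i $ j))"

definition width_matrix :: "complex^'n^'n::finite \<Rightarrow> bool" where
  "width_matrix C \<longleftrightarrow> transpose C = C \<and> (\<forall>v. v \<noteq> 0 \<longrightarrow> v \<bullet> (Im_matrix C *v v) > 0)"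

definition real_eigenvalue :: "real^'n^'n::finite \<Rightarrow> real \<Rightarrow> bool" where
  "real_eigenvalue M l \<longleftrightarrow> (\<exists>v. v \<noteq> 0 \<and> M *v v = l *\<^sub>R v)"

definition gaussian ::
  "real \<Rightarrow> real^'n \<Rightarrow> real^'n \<Rightarrow> complex^'n^'n \<Rightarrow> complex \<Rightarrow> real^'n::finite \<Rightarrow> complex" where
  "gaussian \<epsilon> q p C \<zeta> x =
     exp (\<i> / of_real \<epsilon> *
       ((1 / 2) * (\<Sum>i\<in>UNIV. \<Sum>j\<in>UNIV. of_real ((x - q) $ i) * C $ i $ j * of_real ((x - q) $ j))
        + of_real ((x - q) \<bullet> p) + \<zeta>))"

definition wave_packets :: "real \<Rightarrow> (real^'n::finite \<Rightarrow> complex) set" where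
  "wave_packets \<epsilon> = {gaussian \<epsilon> q p C \<zeta> | q p C \<zeta>. width_matrix C}"

definition quadratic_polys :: "(real^'n::finite \<Rightarrow> complex) set" where
  "quadratic_polys = {\<phi>. \<exists>a (b :: complex^'n) (M :: complex^'n^'n). \<forall>x.
     \<phi> x = a + (\<Sum>i\<in>UNIV. b $ i * of_real (x $ i))
             + (\<Sum>i\<in>UNIV. \<Sum>j\<in>UNIV. M $ i $ j * of_real (x $ i) * of_real (x $ j))}"

definition tangent_space :: "(real^'n::finite \<Rightarrow> complex) \<Rightarrow> (real^'n \<Rightarrow> complex) set" where
  "tangent_space u = {\<lambda>x. \<phi> x * u x | \<phi>. \<phi> \<in> quadratic_polys}"

definition variational_solution ::
  "real \<Rightarrow> (real \<Rightarrow> real^'n \<Rightarrow> real^'n) \<Rightarrow> (real \<Rightarrow> real^'n \<Rightarrow> real) \<Rightarrow> real \<Rightarrow>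
   (real^'n::finite \<Rightarrow> complex) \<Rightarrow> (real \<Rightarrow> real^'n \<Rightarrow> complex) \<Rightarrow> bool" where
  "variational_solution \<epsilon> A V T u0 u \<longleftrightarrow>
     u 0 = u0 \<and>
     (\<forall>t\<in>{0..T}. u t \<in> wave_packets \<epsilon>) \<and>
     (\<forall>t\<in>{0..T}. \<exists>du. has_L2_derivative u du t {0..T} \<and>
        (AE x in lborel.
           \<i> * of_real \<epsilon> * du x = L2_proj (tangent_space (u t)) (hamiltonian \<epsilon> A V t (u t)) x))"

end

theory Submission
  imports Defs
begin

text \<open>
  Write \<open>w(s) = U(\<tau>,s) u(s)\<close>, so that \<open>w(\<tau>) - w(0) = u(\<tau>) - \<psi>(\<tau>)\<close>. Differentiating,
  \<open>w'(s) = U(\<tau>,s) r(s)\<close> with \<open>r(s) = (i/\<epsilon>)(H u - P H u)(s)\<close>, the defect of the variational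
  solution. It is orthogonal to \<open>u(s)\<close>, whence the norm of \<open>u\<close> is conserved. By best
  approximation the norm of \<open>r(s)\<close> is at most \<open>1/\<epsilon>\<close> times the distance of \<open>H u\<close> to any
  quadratic polynomial times \<open>u\<close>. As \<open>H u\<close> is \<open>u\<close> times an explicit function built from \<open>A\<close>, \<open>|A|\<^sup>2/2 + V\<close>
  and affine functions, Taylor expansion at the centre \<open>q\<close> leaves a remainder of order
  \<open>|x - q|\<^sup>3\<close>, and \<open>|x - q|\<^sup>3 u\<close> has norm \<open>O(\<epsilon>\<^bsup>3/2\<^esup>)\<close>.
\<close>

section \<open>The space of square-integrable functions\<close>

text \<open>The propagator is differentiated in its starting time, because there the generator falls
  on \<open>u(s)\<close>, a Schwartz function on which the Hamiltonian acts classically and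
  explicitly. In the end time it would fall on the evolved state, where it is only given weakly.
  Norm conservation is proved along \<open>w\<close> for a similar reason: read off from
  \<open>u\<close>, it would ask for \<open>L2_inner u (H u)\<close> to be real, whereas for
  \<open>w\<close> unitarity reduces it to the orthogonality of the defect to \<open>u\<close>. It
  enters the final bound because the weighted estimate controls \<open>|x - q|^3 u\<close> only
  relative to the norm of \<open>u\<close>. The delicate term is the product of \<open>A\<close>
  with the affine function \<open>C (x - q) + p\<close> that comes from differentiating the
  Gaussian. A quadratic approximation of \<open>A\<close> times this function would have degree 3,
  so its two parts are paired with Taylor polynomials of \<open>A\<close> of different
  orders.\<close>

lemma L2_measurable [measurable_dest]: "f \<in> L2 \<Longrightarrow> f \<in> borel_measurable lborel"
  by (simp add: L2_def)

lemma L2_sq_integrable: "f \<in> L2 \<Longrightarrow> integrable lborel (\<lambda>x. (cmod (f x))\<^sup>2)"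
  by (simp add: L2_def)

lemma borel_measurable_cnj [measurable (raw)]:
  "f \<in> borel_measurable N \<Longrightarrow> (\<lambda>x. cnj (f x)) \<in> borel_measurable N"
  by (rule borel_measurable_continuous_on[of cnj]) (intro continuous_intros)

lemma L2_scale [intro]: "f \<in> L2 \<Longrightarrow> (\<lambda>x. a * f x) \<in> L2"
  by (auto simp: L2_def norm_mult power_mult_distrib)

lemma norm_add_sq_le: "(cmod (a + b))\<^sup>2 \<le> 2 * (cmod a)\<^sup>2 + 2 * (cmod b)\<^sup>2"
proof -
  have "(cmod (a + b))\<^sup>2 \<le> (cmod a + cmod b)\<^sup>2"
    by (intro power_mono norm_triangle_ineq) auto
  also have "\<dots> \<le> 2 * (cmod a)\<^sup>2 + 2 * (cmod b)\<^sup>2"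
    using sum_squares_bound[of "cmod a" "cmod b"] by (simp add: power2_sum)
  finally show ?thesis .
qed

lemma L2_dominated:
  assumes "f \<in> borel_measurable lborel" "integrable lborel F" "\<And>x. (cmod (f x))\<^sup>2 \<le> F x"
  shows "f \<in> L2"
  unfolding L2_def
proof (intro CollectI conjI assms(1))
  show "integrable lborel (\<lambda>x. (cmod (f x))\<^sup>2)"
  proof (rule Bochner_Integration.integrable_bound[OF assms(2)])
    show "(\<lambda>x. (cmod (f x))\<^sup>2) \<in> borel_measurable lborel" using assms(1) by measurable
    show "AE x in lborel. norm ((cmod (f x))\<^sup>2) \<le> norm (F x)"
      using assms(3) by (intro AE_I2) (auto intro: order_trans[OF _ abs_ge_self])
  qed
qed

lemma L2_add [intro]:
  assumes "f \<in> L2" "g \<in> L2" shows "(\<lambda>x. f x + g x) \<in> L2"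
proof (rule L2_dominated[where F = "\<lambda>x. 2 * (cmod (f x))\<^sup>2 + 2 * (cmod (g x))\<^sup>2"])
  show "(\<lambda>x. f x + g x) \<in> borel_measurable lborel"
    using assms[THEN L2_measurable] by measurable
qed (simp_all add: norm_add_sq_le L2_sq_integrable assms)

lemma L2_diff [intro]:
  assumes "f \<in> L2" "g \<in> L2" shows "(\<lambda>x. f x - g x) \<in> L2"
  using L2_add[OF assms(1) L2_scale[OF assms(2), of "-1"]] by simp

lemma L2_zero [intro, simp]: "(\<lambda>x. 0) \<in> L2"
  by (simp add: L2_def)

lemma L2_divide [intro]: "f \<in> L2 \<Longrightarrow> (\<lambda>x. f x / a) \<in> L2"
  using L2_scale[of f "1 / a"] by simp

lemma L2_sum [intro]:
  "(\<And>i. i \<in> I \<Longrightarrow> f i \<in> L2) \<Longrightarrow> (\<lambda>x. \<Sum>i\<in>I. f i x) \<in> L2"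
  by (induction I rule: infinite_finite_induct) auto

lemma L2_inner_integrable:
  assumes "f \<in> L2" "g \<in> L2"
  shows "integrable lborel (\<lambda>x. cnj (f x) * g x)"
proof (rule Bochner_Integration.integrable_bound[where f = "\<lambda>x. (cmod (f x))\<^sup>2 + (cmod (g x))\<^sup>2"])
  show "integrable lborel (\<lambda>x. (cmod (f x))\<^sup>2 + (cmod (g x))\<^sup>2)"
    using assms by (auto intro: L2_sq_integrable)
  show "(\<lambda>x. cnj (f x) * g x) \<in> borel_measurable lborel"
    using assms[THEN L2_measurable] by simp
  have "cmod (f x) * cmod (g x) \<le> (cmod (f x))\<^sup>2 + (cmod (g x))\<^sup>2" for x
    using sum_squares_bound[of "cmod (f x)" "cmod (g x)"]
      mult_nonneg_nonneg[OF norm_ge_zero[of "f x"] norm_ge_zero[of "g x"]] by linarith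
  then show "AE x in lborel. norm (cnj (f x) * g x) \<le> norm ((cmod (f x))\<^sup>2 + (cmod (g x))\<^sup>2)"
    by (simp add: norm_mult)
qed

section \<open>Inner product and norm\<close>

lemma L2_inner_add_right:
  "f \<in> L2 \<Longrightarrow> g \<in> L2 \<Longrightarrow> h \<in> L2 \<Longrightarrow> L2_inner f (\<lambda>x. g x + h x) = L2_inner f g + L2_inner f h"
  unfolding L2_inner_def by (simp add: distrib_left L2_inner_integrable)

lemma L2_inner_scale_right: "L2_inner f (\<lambda>x. a * g x) = a * L2_inner f g"
  unfolding L2_inner_def by (simp add: mult.left_commute[of _ a])

lemma L2_inner_cnj: "cnj (L2_inner f g) = L2_inner g f"
proof -
  have "cnj (L2_inner f g) = (LINT x|lborel. cnj (cnj (f x) * g x))"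
    unfolding L2_inner_def by (rule Bochner_Integration.integral_cnj[symmetric])
  then show ?thesis by (simp only: L2_inner_def complex_cnj_mult complex_cnj_cnj mult.commute)
qed

lemma L2_inner_diff_right:
  assumes "f \<in> L2" "g \<in> L2" "h \<in> L2"
  shows "L2_inner f (\<lambda>x. g x - h x) = L2_inner f g - L2_inner f h"
  using L2_inner_add_right[OF assms(1,2) L2_scale[OF assms(3), of "-1"]]
    L2_inner_scale_right[of f "-1" h] by simp

lemma L2_inner_sum_right:
  assumes "f \<in> L2" "\<And>i. i \<in> I \<Longrightarrow> g i \<in> L2"
  shows "L2_inner f (\<lambda>x. \<Sum>i\<in>I. g i x) = (\<Sum>i\<in>I. L2_inner f (g i))"
  using assms
  by (induction I rule: infinite_finite_induct)
     (auto simp: L2_inner_add_right L2_sum, auto simp: L2_inner_def)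

lemma L2_inner_scale_left: "L2_inner (\<lambda>x. a * g x) f = cnj a * L2_inner g f"
  using L2_inner_scale_right[of f a g] by (metis L2_inner_cnj complex_cnj_mult)

lemma L2_inner_add_left:
  "f \<in> L2 \<Longrightarrow> g \<in> L2 \<Longrightarrow> h \<in> L2 \<Longrightarrow> L2_inner (\<lambda>x. g x + h x) f = L2_inner g f + L2_inner h f"
  using L2_inner_add_right[of f g h] by (metis L2_inner_cnj complex_cnj_add)

lemma L2_inner_diff_left:
  "f \<in> L2 \<Longrightarrow> g \<in> L2 \<Longrightarrow> h \<in> L2 \<Longrightarrow> L2_inner (\<lambda>x. g x - h x) f = L2_inner g f - L2_inner h f"
  using L2_inner_diff_right[of f g h] by (metis L2_inner_cnj complex_cnj_diff)

lemma L2_inner_cong_AE: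
  assumes "AE x in lborel. g x = g' x" "f \<in> L2" "g \<in> L2" "g' \<in> L2"
  shows "L2_inner f g = L2_inner f g'"
  unfolding L2_inner_def
proof (rule integral_cong_AE)
  show "(\<lambda>x. cnj (f x) * g x) \<in> borel_measurable lborel"
       "(\<lambda>x. cnj (f x) * g' x) \<in> borel_measurable lborel"
    using assms(2-4)[THEN L2_measurable] by simp_all
qed (use assms(1) in auto)

lemma L2_norm_cong_AE:
  assumes "AE x in lborel. g x = g' x" "g \<in> L2" "g' \<in> L2"
  shows "L2_norm g = L2_norm g'"
  unfolding L2_norm_def
proof (intro arg_cong[of _ _ sqrt] integral_cong_AE)
  show "(\<lambda>x. (cmod (g x))\<^sup>2) \<in> borel_measurable lborel"
       "(\<lambda>x. (cmod (g' x))\<^sup>2) \<in> borel_measurable lborel"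
    using assms(2,3)[THEN L2_measurable] by measurable
qed (use assms(1) in auto)

lemma L2_norm_nonneg [simp]: "0 \<le> L2_norm f"
  by (simp add: L2_norm_def)

lemma L2_norm_sq: "(L2_norm f)\<^sup>2 = (LINT x|lborel. (cmod (f x))\<^sup>2)"
  by (simp add: L2_norm_def)

lemma L2_inner_self: "L2_inner f f = of_real ((L2_norm f)\<^sup>2)"
proof -
  have "cnj z * z = of_real ((cmod z)\<^sup>2)" for z
    by (subst mult.commute, subst complex_norm_square) simp
  then show ?thesis
    unfolding L2_inner_def L2_norm_sq by (simp only: integral_complex_of_real)
qed

lemma L2_norm_eq: "L2_norm f = sqrt (Re (L2_inner f f))"
  by (simp add: L2_inner_self)

lemma L2_norm_scale: "L2_norm (\<lambda>x. a * f x) = cmod a * L2_norm f"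
  by (simp add: L2_norm_def norm_mult power_mult_distrib real_sqrt_mult)

lemma L2_norm_add_sq:
  assumes "f \<in> L2" "g \<in> L2"
  shows "(L2_norm (\<lambda>x. f x + g x))\<^sup>2 = (L2_norm f)\<^sup>2 + 2 * Re (L2_inner f g) + (L2_norm g)\<^sup>2"
proof -
  have "L2_inner (\<lambda>x. f x + g x) (\<lambda>x. f x + g x) =
        L2_inner f f + L2_inner f g + (L2_inner g f + L2_inner g g)"
    using assms by (simp add: L2_inner_add_left L2_inner_add_right L2_add)
  then have "Re (L2_inner (\<lambda>x. f x + g x) (\<lambda>x. f x + g x)) =
        Re (L2_inner f f) + Re (L2_inner f g) + (Re (cnj (L2_inner f g)) + Re (L2_inner g g))"
    by (simp add: L2_inner_cnj)
  then show ?thesis by (simp add: L2_inner_self)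
qed

text \<open>The squared norm of \<open>g - s z f\<close>, with \<open>z\<close> the inner product
  and \<open>s\<close> real, is a nonnegative quadratic in \<open>s\<close>; its minimiser
  \<open>s = 1 / N\<close> gives the claim. Functions are not identified almost everywhere, so the
  norm may vanish on nonzero \<open>f\<close>, and this case is separate.\<close>

lemma L2_Cauchy_Schwarz:
  assumes "f \<in> L2" "g \<in> L2"
  shows "cmod (L2_inner f g) \<le> L2_norm f * L2_norm g"
proof -
  define z where "z = L2_inner f g"
  have ineq: "0 \<le> s\<^sup>2 * (cmod z)\<^sup>2 * (L2_norm f)\<^sup>2 - 2 * s * (cmod z)\<^sup>2 + (L2_norm g)\<^sup>2" for s :: real
  proof -
    let ?a = "- of_real s * z"
    have "Re (cnj ?a * z) = - s * (cmod z)\<^sup>2"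
      unfolding cmod_power2 by (simp add: power2_eq_square algebra_simps)
    moreover have "(cmod ?a)\<^sup>2 = s\<^sup>2 * (cmod z)\<^sup>2"
      by (simp add: norm_mult power_mult_distrib)
    moreover have "(L2_norm (\<lambda>x. ?a * f x + g x))\<^sup>2 =
        (cmod ?a)\<^sup>2 * (L2_norm f)\<^sup>2 + 2 * Re (cnj ?a * z) + (L2_norm g)\<^sup>2"
      unfolding L2_norm_add_sq[OF L2_scale[OF assms(1)] assms(2)] L2_norm_scale L2_inner_scale_left
        z_def[symmetric] power_mult_distrib ..
    ultimately have "(L2_norm (\<lambda>x. ?a * f x + g x))\<^sup>2 =
        s\<^sup>2 * (cmod z)\<^sup>2 * (L2_norm f)\<^sup>2 - 2 * s * (cmod z)\<^sup>2 + (L2_norm g)\<^sup>2"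
      by simp
    then show ?thesis by (metis zero_le_power2)
  qed
  have "(cmod z)\<^sup>2 \<le> (L2_norm f)\<^sup>2 * (L2_norm g)\<^sup>2"
  proof (cases "L2_norm f = 0 \<or> z = 0")
    case True
    show ?thesis
    proof (cases "z = 0")
      case False
      with True have "L2_norm f = 0" by simp
      \<comment> \<open>With \<open>L2_norm f = 0\<close> the quadratic degenerates to a linear
        function of \<open>s\<close>; the chosen \<open>s\<close> makes its value -1.\<close>
      with ineq[of "((L2_norm g)\<^sup>2 + 1) / (2 * (cmod z)\<^sup>2)"] False show ?thesis by simp
    qed simp
  next
    case False
    define N where "N = (L2_norm f)\<^sup>2"
    have "N > 0" using False by (simp add: N_def)
    then have "(1 / N)\<^sup>2 * (cmod z)\<^sup>2 * N = (cmod z)\<^sup>2 / N" by (simp add: power2_eq_square)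
    with ineq[of "1 / N"] have "(cmod z)\<^sup>2 / N \<le> (L2_norm g)\<^sup>2"
      unfolding N_def[symmetric] by simp
    with \<open>N > 0\<close> show ?thesis unfolding N_def[symmetric] by (simp add: field_simps)
  qed
  then show ?thesis
    unfolding z_def by (metis L2_norm_nonneg mult_nonneg_nonneg power2_le_imp_le power_mult_distrib)
qed

lemma L2_norm_triangle:
  assumes "f \<in> L2" "g \<in> L2"
  shows "L2_norm (\<lambda>x. f x + g x) \<le> L2_norm f + L2_norm g"
proof (rule power2_le_imp_le)
  have "Re (L2_inner f g) \<le> L2_norm f * L2_norm g"
    using complex_Re_le_cmod L2_Cauchy_Schwarz[OF assms] by (rule order_trans)
  then show "(L2_norm (\<lambda>x. f x + g x))\<^sup>2 \<le> (L2_norm f + L2_norm g)\<^sup>2"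
    by (simp add: L2_norm_add_sq[OF assms] power2_sum)
qed simp

section \<open>Orthogonal projection onto finite spans\<close>

text \<open>A Gram-Schmidt step in which the family may be dependent. The induction hypothesis is
  applied both to \<open>b k\<close> and to \<open>f\<close>, giving residuals \<open>e\<close> and
  \<open>r\<close>; then \<open>r - a e\<close> is orthogonal to the old vectors for every
  \<open>a\<close>, and \<open>a\<close> is fixed by orthogonality to \<open>e\<close>, hence to
  \<open>b k\<close>, which is \<open>e\<close> plus old vectors.\<close>

lemma L2_proj_span_exists:
  assumes "finite I" "\<And>i. i \<in> I \<Longrightarrow> b i \<in> L2" "f \<in> L2"
  shows "\<exists>c. \<forall>j\<in>I. L2_inner (b j) (\<lambda>x. f x - (\<Sum>i\<in>I. c i * b i x)) = 0"
  using assms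
proof (induction I arbitrary: f rule: finite_induct)
  case (insert k I)
  have bI: "\<And>i. i \<in> I \<Longrightarrow> b i \<in> L2" and bk: "b k \<in> L2" using insert.prems by auto
  obtain d where d: "\<forall>j\<in>I. L2_inner (b j) (\<lambda>x. b k x - (\<Sum>i\<in>I. d i * b i x)) = 0"
    using insert.IH[OF bI bk] by blast
  obtain c where c: "\<forall>j\<in>I. L2_inner (b j) (\<lambda>x. f x - (\<Sum>i\<in>I. c i * b i x)) = 0"
    using insert.IH[OF bI insert.prems(2)] by blast
  define e where "e x = b k x - (\<Sum>i\<in>I. d i * b i x)" for x
  define r where "r x = f x - (\<Sum>i\<in>I. c i * b i x)" for x
  have sum_L2: "(\<lambda>x. \<Sum>i\<in>I. s i * b i x) \<in> L2" for s
    using bI by (intro L2_sum L2_scale)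
  have L: "e \<in> L2" "r \<in> L2"
    unfolding e_def r_def using sum_L2 bk insert.prems(2) by (simp_all add: L2_diff)
  have e_orth: "L2_inner (b j) e = 0" if "j \<in> I" for j using d that unfolding e_def by auto
  have r_orth: "L2_inner (b j) r = 0" if "j \<in> I" for j using c that unfolding r_def by auto
  define a where "a = L2_inner e r / L2_inner e e"
  have e_r: "L2_inner e (\<lambda>x. r x - a * e x) = 0"
  proof (cases "L2_inner e e = 0")
    \<comment> \<open>Here \<open>b k\<close> lies in the old span up to null sets, and
      Cauchy-Schwarz makes every product with \<open>e\<close> vanish.\<close>
    case True
    then have "L2_norm e = 0" by (simp add: L2_inner_self)
    with L2_Cauchy_Schwarz[OF L(1) L2_diff[OF L(2) L2_scale[OF L(1), of a]]] show ?thesis by simp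
  next
    case False
    then have "a * L2_inner e e = L2_inner e r" by (simp add: a_def)
    then show ?thesis using L
      by (simp add: L2_inner_diff_right L2_scale L2_inner_scale_right)
  qed
  define c' where "c' i = (if i = k then a else c i - a * d i)" for i
  have sum_eq: "f x - (\<Sum>i\<in>insert k I. c' i * b i x) = r x - a * e x" for x
  proof -
    have "(\<Sum>i\<in>I. c' i * b i x) = (\<Sum>i\<in>I. c i * b i x - a * (d i * b i x))"
      using insert.hyps by (intro sum.cong) (auto simp: c'_def algebra_simps)
    also have "\<dots> = (\<Sum>i\<in>I. c i * b i x) - a * (\<Sum>i\<in>I. d i * b i x)"
      by (simp add: sum_subtractf sum_distrib_left)
    finally show ?thesis
      using insert.hyps by (simp add: e_def r_def c'_def algebra_simps)
  qed
  have orth: "L2_inner (b j) (\<lambda>x. r x - a * e x) = 0" if "j \<in> I" for j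
    using L bI[OF that] e_orth[OF that] r_orth[OF that]
    by (simp add: L2_inner_diff_right L2_scale L2_inner_scale_right)
  have "L2_inner (b k) (\<lambda>x. r x - a * e x) = 0"
  proof -
    have "b k = (\<lambda>x. e x + (\<Sum>i\<in>I. d i * b i x))" by (simp add: e_def)
    then have "L2_inner (b k) (\<lambda>x. r x - a * e x) =
          L2_inner e (\<lambda>x. r x - a * e x) + L2_inner (\<lambda>x. \<Sum>i\<in>I. d i * b i x) (\<lambda>x. r x - a * e x)"
      using L bI by (simp add: L2_inner_add_left L2_diff L2_scale L2_sum)
    also have "L2_inner (\<lambda>x. \<Sum>i\<in>I. d i * b i x) (\<lambda>x. r x - a * e x) =
               cnj (L2_inner (\<lambda>x. r x - a * e x) (\<lambda>x. \<Sum>i\<in>I. d i * b i x))"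
      by (simp add: L2_inner_cnj)
    also have "L2_inner (\<lambda>x. r x - a * e x) (\<lambda>x. \<Sum>i\<in>I. d i * b i x) = 
               (\<Sum>i\<in>I. d i * cnj (L2_inner (b i) (\<lambda>x. r x - a * e x)))"
      using L bI by (subst L2_inner_sum_right) (auto simp: L2_inner_scale_right L2_inner_cnj)
    also have "\<dots> = 0" using orth by simp
    finally show ?thesis using e_r by simp
  qed
  then show ?case using orth unfolding sum_eq[symmetric] by blast
qed simp

text \<open>The error \<open>f - g\<close> is orthogonal to both \<open>g\<close> and
  \<open>h\<close>, so its squared norm equals its inner product with \<open>f - h\<close>;
  Cauchy-Schwarz then cancels one factor.\<close>

lemma L2_proj_best_approx:
  assumes "g \<in> S" "\<And>h. h \<in> S \<Longrightarrow> L2_inner h (\<lambda>x. f x - g x) = 0"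
    and "h \<in> S" "S \<subseteq> L2" "f \<in> L2"
  shows "L2_norm (\<lambda>x. f x - g x) \<le> L2_norm (\<lambda>x. f x - h x)"
proof -
  let ?d = "\<lambda>x. f x - g x"
  have L: "g \<in> L2" "h \<in> L2" "?d \<in> L2" using assms by auto
  have "L2_inner (\<lambda>x. f x - h x) ?d = L2_inner f ?d - L2_inner g ?d"
    using assms(2)[OF assms(1)] assms(2)[OF assms(3)] L assms(5) by (simp add: L2_inner_diff_left)
  also have "\<dots> = L2_inner ?d ?d"
    using L assms(5) by (simp add: L2_inner_diff_left)
  finally have "(L2_norm ?d)\<^sup>2 = cmod (L2_inner (\<lambda>x. f x - h x) ?d)"
    by (metis L2_inner_self abs_power2 norm_of_real)
  also have "\<dots> \<le> L2_norm (\<lambda>x. f x - h x) * L2_norm ?d"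
    using L assms(5) by (intro L2_Cauchy_Schwarz) auto
  finally show ?thesis
    by (cases "L2_norm ?d = 0") (auto simp: power2_eq_square mult_le_cancel_right less_le)
qed

section \<open>Differentiation of square-integrable functions\<close>

text \<open>Pairing with a fixed \<open>f\<close> turns a curve in L2 into a real function, to which
  one-variable calculus applies; by Cauchy-Schwarz the error of the difference quotient is at most
  \<open>L2_norm f\<close> times that of the curve.\<close>

lemma L2_derivative_inner:
  assumes "has_L2_derivative w dw t S" "t \<in> S" "f \<in> L2"
  shows "((\<lambda>s. Re (L2_inner f (w s))) has_real_derivative Re (L2_inner f dw)) (at t within S)"
proof -
  define r where "r s = (\<lambda>x. (w s x - w t x) / of_real (s - t) - dw x)" for s
  have L: "dw \<in> L2" "\<And>s. s \<in> S \<Longrightarrow> w s \<in> L2" "w t \<in> L2"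
    and lim: "((\<lambda>s. L2_norm (r s)) \<longlongrightarrow> 0) (at t within S)"
    using assms by (auto simp: has_L2_derivative_def r_def)
  have rL: "r s \<in> L2" if "s \<in> S" for s
    unfolding r_def using L(1,3) L(2)[OF that] by (intro L2_diff L2_divide)
  have eq: "(Re (L2_inner f (w s)) - Re (L2_inner f (w t))) / (s - t) - Re (L2_inner f dw) =
            Re (L2_inner f (r s))" if "s \<in> S" for s
  proof -
    have "L2_inner f (r s) = L2_inner f (\<lambda>x. of_real (1 / (s - t)) * (w s x - w t x)) - L2_inner f dw"
      unfolding r_def using assms(3) L(1,3) L(2)[OF that]
      by (subst L2_inner_diff_right[symmetric]) (auto simp: L2_scale L2_diff)
    also have "\<dots> = of_real (1 / (s - t)) * (L2_inner f (w s) - L2_inner f (w t)) - L2_inner f dw"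
      using assms(3) L(1,3) L(2)[OF that]
      by (simp only: L2_inner_scale_right L2_inner_diff_right)
    finally show ?thesis by (simp del: of_real_divide)
  qed
  have "((\<lambda>s. (Re (L2_inner f (w s)) - Re (L2_inner f (w t))) / (s - t) - Re (L2_inner f dw)) \<longlongrightarrow> 0)
        (at t within S)"
  proof (rule Lim_null_comparison)
    show "\<forall>\<^sub>F s in at t within S. norm ((Re (L2_inner f (w s)) - Re (L2_inner f (w t))) / (s - t) -
            Re (L2_inner f dw)) \<le> L2_norm f * L2_norm (r s)"
    proof (rule eventually_mono[OF eventually_at_topological[THEN iffD2]])
      show "\<exists>U. open U \<and> t \<in> U \<and> (\<forall>x\<in>U. x \<noteq> t \<longrightarrow> x \<in> S \<longrightarrow> x \<in> S)" by blast
      fix s assume "s \<in> S"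
      have "\<bar>Re (L2_inner f (r s))\<bar> \<le> L2_norm f * L2_norm (r s)"
        using abs_Re_le_cmod L2_Cauchy_Schwarz[OF assms(3) rL[OF \<open>s \<in> S\<close>]] by (rule order_trans)
      then show "norm ((Re (L2_inner f (w s)) - Re (L2_inner f (w t))) / (s - t) -
            Re (L2_inner f dw)) \<le> L2_norm f * L2_norm (r s)"
        by (simp only: eq[OF \<open>s \<in> S\<close>] real_norm_def)
    qed
    show "((\<lambda>s. L2_norm f * L2_norm (r s)) \<longlongrightarrow> 0) (at t within S)"
      using tendsto_mult_right_zero[OF lim] .
  qed
  then show ?thesis
    by (simp add: has_field_derivative_iff Lim_null[symmetric])
qed

text \<open>Writing \<open>w s = w t + d s\<close> splits the squared norm into an affine function
  of the real part of \<open>L2_inner (w t) (w s)\<close>, handled by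
  \<open>L2_derivative_inner\<close>, and the square of \<open>L2_norm (d s)\<close>, which is of
  second order in \<open>s - t\<close>.\<close>

lemma L2_derivative_norm_sq:
  assumes "has_L2_derivative w dw t S" "t \<in> S"
  shows "((\<lambda>s. (L2_norm (w s))\<^sup>2) has_real_derivative 2 * Re (L2_inner (w t) dw)) (at t within S)"
proof -
  define r where "r s = (\<lambda>x. (w s x - w t x) / of_real (s - t) - dw x)" for s
  have L: "dw \<in> L2" "\<And>s. s \<in> S \<Longrightarrow> w s \<in> L2" "w t \<in> L2"
    and lim: "((\<lambda>s. L2_norm (r s)) \<longlongrightarrow> 0) (at t within S)"
    using assms by (auto simp: has_L2_derivative_def r_def)
  have rL: "r s \<in> L2" if "s \<in> S" for s
    unfolding r_def using L(1,3) L(2)[OF that] by (intro L2_diff L2_divide)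
  have ev: "\<forall>\<^sub>F s in at t within S. s \<in> S \<and> s \<noteq> t"
    by (auto simp: eventually_at_topological)
  define d where "d s = (\<lambda>x. w s x - w t x)" for s
  have d_norm: "L2_norm (d s) \<le> \<bar>s - t\<bar> * (L2_norm (r s) + L2_norm dw)" if "s \<in> S" "s \<noteq> t" for s
  proof -
    have "d s = (\<lambda>x. of_real (s - t) * (r s x + dw x))"
      using that by (auto simp: d_def r_def simp del: of_real_diff)
    then have "L2_norm (d s) = \<bar>s - t\<bar> * L2_norm (\<lambda>x. r s x + dw x)"
      by (simp only: L2_norm_scale norm_of_real)
    also have "\<dots> \<le> \<bar>s - t\<bar> * (L2_norm (r s) + L2_norm dw)"
      by (intro mult_left_mono L2_norm_triangle rL L that) auto
    finally show ?thesis .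
  qed
  have "((\<lambda>s. (L2_norm (d s))\<^sup>2) has_real_derivative 0) (at t within S)"
  proof -
    have "((\<lambda>s. (L2_norm (d s))\<^sup>2 / (s - t)) \<longlongrightarrow> 0) (at t within S)"
    proof (rule Lim_null_comparison)
      show "\<forall>\<^sub>F s in at t within S. norm ((L2_norm (d s))\<^sup>2 / (s - t)) \<le>
              \<bar>s - t\<bar> * (L2_norm (r s) + L2_norm dw)\<^sup>2"
        using ev
      proof eventually_elim
        case (elim s)
        have "(L2_norm (d s))\<^sup>2 \<le> (\<bar>s - t\<bar> * (L2_norm (r s) + L2_norm dw))\<^sup>2"
          using d_norm elim by (intro power_mono) auto
        then show ?case using elim
          by (simp add: divide_le_eq power2_eq_square algebra_simps)
      qed
      have "((\<lambda>s. \<bar>s - t\<bar> * (L2_norm (r s) + L2_norm dw)\<^sup>2) \<longlongrightarrow>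
              \<bar>t - t\<bar> * (0 + L2_norm dw)\<^sup>2) (at t within S)"
        by (intro tendsto_intros lim)
      then show "((\<lambda>s. \<bar>s - t\<bar> * (L2_norm (r s) + L2_norm dw)\<^sup>2) \<longlongrightarrow> 0) (at t within S)"
        by simp
    qed
    moreover have "L2_norm (d t) = 0" by (simp add: d_def L2_norm_def)
    ultimately show ?thesis by (simp add: has_field_derivative_iff)
  qed
  from DERIV_diff[OF DERIV_add[OF DERIV_cmult[OF L2_derivative_inner[OF assms L(3)], of 2] this]
      DERIV_const[of "(L2_norm (w t))\<^sup>2"]]
  have D: "((\<lambda>s. (2 * Re (L2_inner (w t) (w s)) + (L2_norm (d s))\<^sup>2) - (L2_norm (w t))\<^sup>2)
           has_real_derivative 2 * Re (L2_inner (w t) dw)) (at t within S)"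
    by simp
  show ?thesis
  proof (rule has_field_derivative_transform_within[OF D zero_less_one assms(2)])
    fix s assume s: "s \<in> S"
    have "(L2_norm (w s))\<^sup>2 = (L2_norm (\<lambda>x. w t x + d s x))\<^sup>2" by (simp add: d_def)
    also have "\<dots> = (L2_norm (w t))\<^sup>2 + 2 * Re (L2_inner (w t) (d s)) + (L2_norm (d s))\<^sup>2"
      by (rule L2_norm_add_sq) (auto simp: d_def L s L2_diff)
    also have "L2_inner (w t) (d s) = L2_inner (w t) (w s) - L2_inner (w t) (w t)"
      by (simp add: d_def L2_inner_diff_right L s)
    finally show "2 * Re (L2_inner (w t) (w s)) + (L2_norm (d s))\<^sup>2 - (L2_norm (w t))\<^sup>2 =
        (L2_norm (w s))\<^sup>2"
      by (simp add: L2_inner_self)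
  qed
qed

text \<open>Vector-valued curves have no mean value equality, so the curve is tested with its own
  total increment \<open>f\<close>; the real mean value theorem and Cauchy-Schwarz bound the square
  of \<open>L2_norm f\<close>, and one factor cancels.\<close>

lemma L2_mean_value:
  fixes a b :: real
  assumes "a \<le> b" "\<And>s. s \<in> {a..b} \<Longrightarrow> has_L2_derivative w (dw s) s {a..b}"
    and "\<And>s. s \<in> {a..b} \<Longrightarrow> L2_norm (dw s) \<le> B"
  shows "L2_norm (\<lambda>x. w b x - w a x) \<le> (b - a) * B"
proof (cases "a < b")
  case True
  have L: "w s \<in> L2" "dw s \<in> L2" if "s \<in> {a..b}" for s
    using assms(2)[OF that] that by (auto simp: has_L2_derivative_def)
  define f where "f x = w b x - w a x" for x
  have f: "f \<in> L2" unfolding f_def using L(1)[of a] L(1)[of b] True by auto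
  have cont: "continuous_on {a..b} (\<lambda>s. Re (L2_inner f (w s)))"
    unfolding continuous_on_eq_continuous_within
    using L2_derivative_inner[OF assms(2) _ f] by (blast intro: DERIV_continuous)
  have der: "((\<lambda>s. Re (L2_inner f (w s))) has_real_derivative Re (L2_inner f (dw s))) (at s)"
    if "a < s" "s < b" for s
    using L2_derivative_inner[OF assms(2)[of s] _ f] that
    by (simp add: at_within_Icc_at)
  obtain \<xi> where \<xi>: "a < \<xi>" "\<xi> < b" and mv:
    "Re (L2_inner f (w b)) - Re (L2_inner f (w a)) = (b - a) * Re (L2_inner f (dw \<xi>))"
    using MVT[OF True cont] der by (metis DERIV_unique real_differentiable_def)
  have "(L2_norm f)\<^sup>2 = Re (L2_inner f (w b)) - Re (L2_inner f (w a))"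
  proof -
    have "L2_inner f f = L2_inner f (w b) - L2_inner f (w a)"
      using L2_inner_diff_right[OF f L(1)[of b] L(1)[of a]] True unfolding f_def by simp
    then show ?thesis by (metis L2_inner_self Re_complex_of_real minus_complex.simps(1))
  qed
  also have "\<dots> \<le> (b - a) * (L2_norm f * B)"
    unfolding mv
  proof (intro mult_left_mono)
    have "Re (L2_inner f (dw \<xi>)) \<le> L2_norm f * L2_norm (dw \<xi>)"
      using complex_Re_le_cmod L2_Cauchy_Schwarz[OF f L(2)] \<xi> by (meson atLeastAtMost_iff less_imp_le order_trans)
    also have "\<dots> \<le> L2_norm f * B"
      using assms(3) \<xi> by (intro mult_left_mono) auto
    finally show "Re (L2_inner f (dw \<xi>)) \<le> L2_norm f * B" .
  qed (use True in auto)
  finally have "L2_norm f * L2_norm f \<le> L2_norm f * ((b - a) * B)"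
    by (simp add: power2_eq_square mult_ac)
  moreover have "0 \<le> (b - a) * B"
    using True order_trans[OF L2_norm_nonneg assms(3)[of a]] by (intro mult_nonneg_nonneg) auto
  ultimately show ?thesis
    unfolding f_def[symmetric] by (cases "L2_norm f = 0") (auto simp: less_le mult_le_cancel_left)
next
  case False
  then show ?thesis using assms(1) by (simp add: L2_norm_def)
qed

lemma L2_norm_constant:
  fixes a b :: real
  assumes "s \<in> {a..b}" "\<And>s. s \<in> {a..b} \<Longrightarrow> has_L2_derivative w (dw s) s {a..b}"
    and "\<And>s. s \<in> {a..b} \<Longrightarrow> Re (L2_inner (w s) (dw s)) = 0"
  shows "L2_norm (w s) = L2_norm (w a)"
proof -
  have "\<exists>c. \<forall>s\<in>{a..b}. (L2_norm (w s))\<^sup>2 = c"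
    using L2_derivative_norm_sq[OF assms(2)] assms(3)
    by (intro has_field_derivative_zero_constant) (auto simp del: atLeastAtMost_iff)
  then have "(L2_norm (w s))\<^sup>2 = (L2_norm (w a))\<^sup>2"
    using assms(1) by (metis atLeastAtMost_iff order_refl order_trans)
  then show ?thesis by simp
qed

section \<open>Unitary evolution\<close>

lemma L2_unitary_L2: "L2_unitary W \<Longrightarrow> f \<in> L2 \<Longrightarrow> W f \<in> L2"
  by (simp add: L2_unitary_def)

lemma L2_unitary_inner:
  "L2_unitary W \<Longrightarrow> f \<in> L2 \<Longrightarrow> g \<in> L2 \<Longrightarrow> L2_inner (W f) (W g) = L2_inner f g"
  by (simp add: L2_unitary_def)

lemma L2_unitary_norm: "L2_unitary W \<Longrightarrow> f \<in> L2 \<Longrightarrow> L2_norm (W f) = L2_norm f"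
  by (simp add: L2_norm_eq L2_unitary_inner)

lemma L2_unitary_add_scale:
  assumes "L2_unitary W" "f \<in> L2" "g \<in> L2"
  shows "AE x in lborel. W (\<lambda>y. f y + b * g y) x = W f x + b * W g x"
proof -
  have "AE x in lborel. W (\<lambda>y. 1 * f y + b * g y) x = 1 * W f x + b * W g x"
    using assms unfolding L2_unitary_def by blast
  then show ?thesis by simp
qed

lemma evolution_derivative:
  assumes U: "unitary_evolution_family U" and gen: "generated_by_hamiltonian \<epsilon> A V U"
    and "schwartz (u s)" "has_L2_derivative u du s S" "s \<in> S"
    and H: "hamiltonian \<epsilon> A V s (u s) \<in> L2" and "\<epsilon> > 0"
  shows "has_L2_derivative (\<lambda>s'. U \<tau> s' (u s'))
           (U \<tau> s (\<lambda>x. du x + \<i> / of_real \<epsilon> * hamiltonian \<epsilon> A V s (u s) x)) s S"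
proof -
  define h where "h = hamiltonian \<epsilon> A V s (u s)"
  define r where "r x = du x + \<i> / of_real \<epsilon> * h x" for x
  have hL: "h \<in> L2" using H by (simp add: h_def)
  have unit: "L2_unitary (U \<tau> s')" for s'
    using U by (simp add: unitary_evolution_family_def)
  have uL: "\<And>s'. s' \<in> S \<Longrightarrow> u s' \<in> L2" "u s \<in> L2" "du \<in> L2"
    using assms(4,5) by (auto simp: has_L2_derivative_def)
  have rL: "r \<in> L2" unfolding r_def by (intro L2_add L2_scale uL(3) hL)
  obtain d where d: "has_L2_derivative (\<lambda>s'. U \<tau> s' (u s)) d s UNIV"
    and d_eq: "AE x in lborel. \<i> * of_real \<epsilon> * d x = - U \<tau> s h x"
    using gen assms(3) unfolding generated_by_hamiltonian_def h_def by blast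
  have dL: "d \<in> L2" using d by (simp add: has_L2_derivative_def)
  have d_eq': "AE x in lborel. d x = \<i> / of_real \<epsilon> * U \<tau> s h x"
    using d_eq
  proof eventually_elim
    case (elim x)
    \<comment> \<open>The inverse of \<open>\<i> * \<epsilon>\<close> is
      \<open>- \<i> / \<epsilon>\<close>; with the minus sign of the backward equation the result is
      \<open>+ \<i> / \<epsilon>\<close>.\<close>
    have "d x = - \<i> / of_real \<epsilon> * (\<i> * of_real \<epsilon> * d x)"
      using \<open>\<epsilon> > 0\<close> by (simp add: field_simps)
    then show ?case unfolding elim by simp
  qed
  have Ur: "AE x in lborel. U \<tau> s r x = U \<tau> s du x + \<i> / of_real \<epsilon> * U \<tau> s h x"
    unfolding r_def by (rule L2_unitary_add_scale[OF unit uL(3) hL])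

  define E where "E s' = (\<lambda>x. (u s' x - u s x) / of_real (s' - s) - du x)" for s'
  define F where "F s' = (\<lambda>x. U \<tau> s' du x - U \<tau> s du x)" for s'
  define G where "G s' = (\<lambda>x. (U \<tau> s' (u s) x - U \<tau> s (u s) x) / of_real (s' - s) - d x)" for s'
  define Q where "Q s' = (\<lambda>x. (U \<tau> s' (u s') x - U \<tau> s (u s) x) / of_real (s' - s) - U \<tau> s r x)" for s'
  have EL: "E s' \<in> L2" if "s' \<in> S" for s'
    unfolding E_def by (intro L2_diff L2_divide uL that)
  have FL: "F s' \<in> L2" for s' unfolding F_def using uL unit by (auto intro: L2_unitary_L2)
  have GL: "G s' \<in> L2" for s'
    unfolding G_def using uL unit dL by (intro L2_diff L2_divide) (auto intro: L2_unitary_L2)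
  have bound: "norm (L2_norm (Q s')) \<le> L2_norm (E s') + L2_norm (F s') + L2_norm (G s')"
    if "s' \<in> S" "s' \<noteq> s" for s'
  proof -
    have QL: "Q s' \<in> L2"
      unfolding Q_def using uL that rL unit by (intro L2_diff L2_divide) (auto intro: L2_unitary_L2)
    have UE: "U \<tau> s' (E s') \<in> L2" using EL that unit by (auto intro: L2_unitary_L2)
    \<comment> \<open>The factor \<open>1\<close> fits \<open>L2_unitary_add_scale\<close>, which is
      applied twice, with coefficients \<open>s' - s\<close> and \<open>1\<close>.\<close>
    have us': "u s' = (\<lambda>x. u s x + of_real (s' - s) * (du x + 1 * E s' x))"
      using that by (auto simp: E_def simp del: of_real_diff)
    have "AE x in lborel. U \<tau> s' (u s') x =
        U \<tau> s' (u s) x + of_real (s' - s) * U \<tau> s' (\<lambda>x. du x + 1 * E s' x) x"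
      by (subst us', rule L2_unitary_add_scale[OF unit]) (use uL EL that in auto)
    moreover have "AE x in lborel. U \<tau> s' (\<lambda>x. du x + 1 * E s' x) x = U \<tau> s' du x + 1 * U \<tau> s' (E s') x"
      by (rule L2_unitary_add_scale[OF unit uL(3) EL[OF that(1)]])
    ultimately have "AE x in lborel. Q s' x = U \<tau> s' (E s') x + (F s' x + G s' x)"
      using Ur d_eq'
    proof eventually_elim
      case (elim x)
      show ?case
        using that(2) unfolding Q_def F_def G_def elim by (simp add: field_simps del: of_real_diff)
    qed
    then have "L2_norm (Q s') = L2_norm (\<lambda>x. U \<tau> s' (E s') x + (F s' x + G s' x))"
      by (rule L2_norm_cong_AE[OF _ QL L2_add[OF UE L2_add[OF FL GL]]])
    also have "\<dots> \<le> L2_norm (U \<tau> s' (E s')) + (L2_norm (F s') + L2_norm (G s'))"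
      using UE FL[of s'] GL[of s'] L2_norm_triangle[of "U \<tau> s' (E s')" "\<lambda>x. F s' x + G s' x"]
        L2_norm_triangle[of "F s'" "G s'"] by (auto simp: L2_add)
    finally show ?thesis using EL that unit by (simp add: L2_unitary_norm)
  qed
  have "((\<lambda>s'. L2_norm (Q s')) \<longlongrightarrow> 0) (at s within S)"
  proof (rule Lim_null_comparison)
    show "\<forall>\<^sub>F s' in at s within S. norm (L2_norm (Q s')) \<le> L2_norm (E s') + L2_norm (F s') + L2_norm (G s')"
      using bound by (auto simp: eventually_at_topological)
    have "((\<lambda>s'. L2_norm (E s')) \<longlongrightarrow> 0) (at s within S)"
      using assms(4) by (simp add: has_L2_derivative_def E_def)
    moreover have "((\<lambda>s'. L2_norm (F s')) \<longlongrightarrow> 0) (at s within S)"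
    proof -
      have "((\<lambda>(t', s'). L2_norm (\<lambda>x. U t' s' du x - U \<tau> s du x)) \<longlongrightarrow> 0) (at (\<tau>, s))"
        using U uL(3) unfolding unitary_evolution_family_def by blast
      \<comment> \<open>Continuity is given on a punctured neighbourhood of
        \<open>(\<tau>, s)\<close>; the path avoids that point because \<open>s'\<close> differs
        from \<open>s\<close>.\<close>
      moreover have "filterlim (\<lambda>s'. (\<tau>, s')) (at (\<tau>, s)) (at s within S)"
        unfolding filterlim_at by (auto intro!: tendsto_intros simp: eventually_at_topological)
      ultimately show ?thesis
        unfolding F_def by (auto dest: filterlim_compose)
    qed
    moreover have "((\<lambda>s'. L2_norm (G s')) \<longlongrightarrow> 0) (at s within S)"
      using d unfolding has_L2_derivative_def G_def
      by (auto intro: tendsto_within_subset)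
    ultimately have "((\<lambda>s'. L2_norm (E s') + L2_norm (F s') + L2_norm (G s')) \<longlongrightarrow> 0 + 0 + 0) (at s within S)"
      by (intro tendsto_add)
    then show "((\<lambda>s'. L2_norm (E s') + L2_norm (F s') + L2_norm (G s')) \<longlongrightarrow> 0) (at s within S)"
      by simp
  qed
  then show ?thesis
    unfolding has_L2_derivative_def Q_def r_def h_def[symmetric]
    using uL(1) unit rL[unfolded r_def] by (auto intro: L2_unitary_L2)
qed

section \<open>Polynomials and the tangent space\<close>

text \<open>Products of two such functions, and sums and multiples of these products, are quadratic;
  membership in \<open>quadratic_polys\<close> thus follows from closure rules instead of explicit
  coefficients.\<close>

definition affine_polys :: "(real^'n::finite \<Rightarrow> complex) set" where
  "affine_polys = {\<phi>. \<exists>a (b :: complex^'n). \<forall>x. \<phi> x = a + (\<Sum>i\<in>UNIV. b $ i * of_real (x $ i))}"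

lemma affine_const: "(\<lambda>x :: real^'n::finite. c) \<in> affine_polys"
proof -
  have "c = c + (\<Sum>i\<in>UNIV. (0::complex^'n) $ i * of_real (x $ i))" for x :: "real^'n" by simp
  then show ?thesis unfolding affine_polys_def by blast
qed

lemma affine_coord: "(\<lambda>x :: real^'n::finite. of_real (x $ i)) \<in> affine_polys"
proof -
  have "of_real (x $ i) = 0 + (\<Sum>j\<in>UNIV. axis i (1::complex) $ j * of_real (x $ j))" for x :: "real^'n"
    by (simp add: axis_def if_distrib[of "\<lambda>z. z * _"] cong: if_cong)
  then show ?thesis unfolding affine_polys_def by blast
qed

lemma affine_add:
  fixes f g :: "real^'n::finite \<Rightarrow> complex"
  assumes "f \<in> affine_polys" "g \<in> affine_polys" shows "(\<lambda>x. f x + g x) \<in> affine_polys"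
proof -
  obtain a b a' b' where "\<forall>x. f x = a + (\<Sum>i\<in>UNIV. b $ i * of_real (x $ i))"
    and "\<forall>x. g x = a' + (\<Sum>i\<in>UNIV. b' $ i * of_real (x $ i))"
    using assms unfolding affine_polys_def by blast
  then have "\<forall>x. f x + g x = (a + a') + (\<Sum>i\<in>UNIV. (b + b') $ i * of_real (x $ i))"
    by (simp add: sum.distrib distrib_right)
  then show ?thesis unfolding affine_polys_def by blast
qed

lemma affine_scale:
  fixes f :: "real^'n::finite \<Rightarrow> complex"
  assumes "f \<in> affine_polys" shows "(\<lambda>x. c * f x) \<in> affine_polys"
proof -
  obtain a b where "\<forall>x. f x = a + (\<Sum>i\<in>UNIV. b $ i * of_real (x $ i))"
    using assms unfolding affine_polys_def by blast
  then have "\<forall>x. c * f x = c * a + (\<Sum>i\<in>UNIV. (\<chi> i. c * b $ i) $ i * of_real (x $ i))"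
    by (simp add: sum_distrib_left distrib_left mult.assoc)
  then show ?thesis unfolding affine_polys_def by blast
qed

lemma affine_sum: "(\<And>i. i \<in> I \<Longrightarrow> f i \<in> affine_polys) \<Longrightarrow> (\<lambda>x. \<Sum>i\<in>I. f i x) \<in> affine_polys"
  by (induction I rule: infinite_finite_induct) (auto intro: affine_const affine_add)

lemma affine_shifted_coord: "(\<lambda>x. of_real ((x - q) $ i)) \<in> affine_polys"
  using affine_add[OF affine_coord[of i] affine_const[of "- of_real (q $ i)"]] by simp

lemma quadratic_add:
  fixes f g :: "real^'n::finite \<Rightarrow> complex"
  assumes "f \<in> quadratic_polys" "g \<in> quadratic_polys" shows "(\<lambda>x. f x + g x) \<in> quadratic_polys"
proof -
  obtain a b and M :: "complex^'n^'n" and a' b' and M' :: "complex^'n^'n" where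
    "\<forall>x. f x = a + (\<Sum>i\<in>UNIV. b $ i * of_real (x $ i))
             + (\<Sum>i\<in>UNIV. \<Sum>j\<in>UNIV. M $ i $ j * of_real (x $ i) * of_real (x $ j))"
    "\<forall>x. g x = a' + (\<Sum>i\<in>UNIV. b' $ i * of_real (x $ i))
             + (\<Sum>i\<in>UNIV. \<Sum>j\<in>UNIV. M' $ i $ j * of_real (x $ i) * of_real (x $ j))"
    using assms unfolding quadratic_polys_def by blast
  then have "\<forall>x. f x + g x = (a + a') + (\<Sum>i\<in>UNIV. (b + b') $ i * of_real (x $ i))
             + (\<Sum>i\<in>UNIV. \<Sum>j\<in>UNIV. (M + M') $ i $ j * of_real (x $ i) * of_real (x $ j))"
    by (simp add: sum.distrib distrib_right)
  then show ?thesis unfolding quadratic_polys_def by blast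
qed

lemma affine_mult_quadratic:
  fixes f g :: "real^'n::finite \<Rightarrow> complex"
  assumes "f \<in> affine_polys" "g \<in> affine_polys" shows "(\<lambda>x. f x * g x) \<in> quadratic_polys"
proof -
  obtain a b a' b' where fg: "\<And>x. f x = a + (\<Sum>i\<in>UNIV. b $ i * of_real (x $ i))"
    "\<And>x. g x = a' + (\<Sum>i\<in>UNIV. b' $ i * of_real (x $ i))"
    using assms unfolding affine_polys_def by blast
  have "f x * g x = a * a' + (\<Sum>i\<in>UNIV. (\<chi> i. a * b' $ i + a' * b $ i) $ i * of_real (x $ i))
     + (\<Sum>i\<in>UNIV. \<Sum>j\<in>UNIV. (\<chi> i j. b $ i * b' $ j) $ i $ j * of_real (x $ i) * of_real (x $ j))" for x
    unfolding fg
    by (simp add: distrib_left distrib_right sum.distrib sum_product sum_distrib_left mult_ac)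
  then show ?thesis unfolding quadratic_polys_def by blast
qed

lemma affine_quadratic: "f \<in> affine_polys \<Longrightarrow> f \<in> quadratic_polys"
  using affine_mult_quadratic[OF _ affine_const[of 1]] by simp

lemma quadratic_scale:
  fixes f :: "real^'n::finite \<Rightarrow> complex"
  assumes "f \<in> quadratic_polys" shows "(\<lambda>x. c * f x) \<in> quadratic_polys"
proof -
  obtain a b and M :: "complex^'n^'n" where
    "\<forall>x. f x = a + (\<Sum>i\<in>UNIV. b $ i * of_real (x $ i))
             + (\<Sum>i\<in>UNIV. \<Sum>j\<in>UNIV. M $ i $ j * of_real (x $ i) * of_real (x $ j))"
    using assms unfolding quadratic_polys_def by blast
  then have "\<forall>x. c * f x = c * a + (\<Sum>i\<in>UNIV. (\<chi> i. c * b $ i) $ i * of_real (x $ i))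
      + (\<Sum>i\<in>UNIV. \<Sum>j\<in>UNIV. (\<chi> i j. c * M $ i $ j) $ i $ j * of_real (x $ i) * of_real (x $ j))"
    by (simp add: sum_distrib_left distrib_left mult.assoc)
  then show ?thesis unfolding quadratic_polys_def by blast
qed

lemma quadratic_sum:
  "(\<And>i. i \<in> I \<Longrightarrow> f i \<in> quadratic_polys) \<Longrightarrow> (\<lambda>x. \<Sum>i\<in>I. f i x) \<in> quadratic_polys"
  by (induction I rule: infinite_finite_induct)
     (auto intro: affine_quadratic affine_const quadratic_add)

lemma quadratic_const: "(\<lambda>x. c) \<in> quadratic_polys"
  by (intro affine_quadratic affine_const)

text \<open>The extra index \<open>None\<close> stands for a coordinate constantly 1, so that every
  monomial of degree at most 2 is a product of two coordinates and one finite index type covers all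
  degrees.\<close>

fun homogenized_coord :: "'n option \<Rightarrow> real^'n::finite \<Rightarrow> complex" where
  "homogenized_coord None x = 1"
| "homogenized_coord (Some i) x = of_real (x $ i)"

lemma sum_option_UNIV:
  fixes f :: "'n::finite option \<Rightarrow> 'b::comm_monoid_add"
  shows "(\<Sum>k\<in>UNIV. f k) = f None + (\<Sum>i\<in>UNIV. f (Some i))"
  by (simp add: UNIV_option_conv sum.reindex)

lemma quadratic_polys_span:
  "quadratic_polys = range (\<lambda>c :: 'n::finite option \<times> 'n option \<Rightarrow> complex.
     \<lambda>x. \<Sum>k\<in>UNIV. c k * (homogenized_coord (fst k) x * homogenized_coord (snd k) x))"
proof (intro equalityI subsetI)
  fix f :: "real^'n \<Rightarrow> complex"
  assume "f \<in> quadratic_polys"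
  then obtain a b and M :: "complex^'n^'n" where f:
    "\<And>x. f x = a + (\<Sum>i\<in>UNIV. b $ i * of_real (x $ i))
             + (\<Sum>i\<in>UNIV. \<Sum>j\<in>UNIV. M $ i $ j * of_real (x $ i) * of_real (x $ j))"
    unfolding quadratic_polys_def by blast
  \<comment> \<open>Linear monomials occur under two index pairs; the coefficient is put on one of
    them and 0 on the other.\<close>
  define c where "c k = (case k of (None, None) \<Rightarrow> a | (Some i, None) \<Rightarrow> b $ i
      | (None, Some j) \<Rightarrow> 0 | (Some i, Some j) \<Rightarrow> M $ i $ j)" for k
  have "f x = (\<Sum>k\<in>UNIV. c k * (homogenized_coord (fst k) x * homogenized_coord (snd k) x))" for x
    unfolding UNIV_Times_UNIV[symmetric] sum.cartesian_product'
    by (simp add: sum_option_UNIV c_def f sum.distrib mult.assoc)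
  then show "f \<in> range (\<lambda>c :: 'n option \<times> 'n option \<Rightarrow> complex.
     \<lambda>x. \<Sum>k\<in>UNIV. c k * (homogenized_coord (fst k) x * homogenized_coord (snd k) x))"
    by blast
next
  have "homogenized_coord k \<in> affine_polys" for k :: "'n option"
  proof (cases k)
    case None
    then have "homogenized_coord k = (\<lambda>x. 1)" by auto
    then show ?thesis by (simp add: affine_const)
  next
    case (Some i)
    then have "homogenized_coord k = (\<lambda>x. of_real (x $ i))" by auto
    then show ?thesis by (simp add: affine_coord)
  qed
  then show "f \<in> quadratic_polys" if "f \<in> range (\<lambda>c :: 'n option \<times> 'n option \<Rightarrow> complex.
     \<lambda>x. \<Sum>k\<in>UNIV. c k * (homogenized_coord (fst k) x * homogenized_coord (snd k) x))" for f
    using that by (auto intro!: quadratic_sum quadratic_scale affine_mult_quadratic)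
qed

text \<open>\<open>L2_proj\<close> is a choice, so its defining property becomes usable once some
  projection exists. The products of homogenized coordinates with \<open>u\<close> are a finite
  spanning family, and \<open>L2_proj_span_exists\<close> applies to it although the family is
  redundant.\<close>

lemma tangent_space_projection:
  fixes u :: "real^'n::finite \<Rightarrow> complex"
  assumes "tangent_space u \<subseteq> L2" "f \<in> L2"
  shows "L2_proj (tangent_space u) f \<in> tangent_space u"
    and "h \<in> tangent_space u \<Longrightarrow> L2_inner h (\<lambda>x. f x - L2_proj (tangent_space u) f x) = 0"
proof -
  define b where "b k x = homogenized_coord (fst k) x * homogenized_coord (snd k) x * u x"
    for k :: "'n option \<times> 'n option" and x
  have "tangent_space u = (\<lambda>\<phi> x. \<phi> x * u x) ` quadratic_polys"
    by (auto simp: tangent_space_def)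
  then have T: "tangent_space u = range (\<lambda>c x. \<Sum>k\<in>UNIV. c k * b k x)"
    unfolding quadratic_polys_span b_def image_image sum_distrib_right mult.assoc .
  have "b k \<in> tangent_space u" for k
    unfolding T
    by (rule range_eqI[of _ _ "\<lambda>l. if l = k then 1 else 0"])
       (simp add: if_distrib[of "\<lambda>z. z * _"] cong: if_cong)
  then have bL: "b k \<in> L2" for k using assms(1) by blast
  obtain c where c: "\<And>j. L2_inner (b j) (\<lambda>x. f x - (\<Sum>k\<in>UNIV. c k * b k x)) = 0"
    using L2_proj_span_exists[of UNIV b f] bL assms(2) by auto
  define g where "g x = (\<Sum>k\<in>UNIV. c k * b k x)" for x
  have gL: "(\<lambda>x. f x - g x) \<in> L2" unfolding g_def using bL assms(2) by (intro L2_diff L2_sum L2_scale) auto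
  have "L2_inner h (\<lambda>x. f x - g x) = 0" if h: "h \<in> tangent_space u" for h
  proof -
    obtain d where d: "h = (\<lambda>x. \<Sum>k\<in>UNIV. d k * b k x)" using h unfolding T by blast
    have "L2_inner (\<lambda>x. f x - g x) (b k) = 0" for k
      using c[of k] unfolding g_def[symmetric] by (metis L2_inner_cnj complex_cnj_zero)
    then have "L2_inner (\<lambda>x. f x - g x) h = 0"
      unfolding d using gL bL by (subst L2_inner_sum_right) (auto simp: L2_inner_scale_right)
    then show ?thesis by (metis L2_inner_cnj complex_cnj_zero)
  qed
  then have "g \<in> tangent_space u \<and> (\<forall>h\<in>tangent_space u. L2_inner h (\<lambda>x. f x - g x) = 0)"
    unfolding T g_def by blast
  then have P: "L2_proj (tangent_space u) f \<in> tangent_space u \<and>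
      (\<forall>h\<in>tangent_space u. L2_inner h (\<lambda>x. f x - L2_proj (tangent_space u) f x) = 0)"
    unfolding L2_proj_def
    by (rule someI[where P = "\<lambda>g. g \<in> tangent_space u \<and>
          (\<forall>h\<in>tangent_space u. L2_inner h (\<lambda>x. f x - g x) = 0)"])
  then show "L2_proj (tangent_space u) f \<in> tangent_space u"
    and "h \<in> tangent_space u \<Longrightarrow> L2_inner h (\<lambda>x. f x - L2_proj (tangent_space u) f x) = 0"
    by blast+
qed

section \<open>Polynomials of arbitrary degree and their growth\<close>

text \<open>Each derivative of a Gaussian brings down another affine factor, so the Schwartz
  property calls for a class of polynomials closed under products.\<close>

inductive_set polyfuns :: "(real^'n::finite \<Rightarrow> complex) set" where
  const: "(\<lambda>x. c) \<in> polyfuns"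
| coord: "(\<lambda>x. of_real (x $ i)) \<in> polyfuns"
| add: "f \<in> polyfuns \<Longrightarrow> g \<in> polyfuns \<Longrightarrow> (\<lambda>x. f x + g x) \<in> polyfuns"
| mult: "f \<in> polyfuns \<Longrightarrow> g \<in> polyfuns \<Longrightarrow> (\<lambda>x. f x * g x) \<in> polyfuns"

lemma polyfuns_sum: "(\<And>i. i \<in> I \<Longrightarrow> f i \<in> polyfuns) \<Longrightarrow> (\<lambda>x. \<Sum>i\<in>I. f i x) \<in> polyfuns"
  by (induction I rule: infinite_finite_induct) (auto intro: polyfuns.intros)

lemma affine_polyfuns:
  fixes f :: "real^'n::finite \<Rightarrow> complex"
  shows "f \<in> affine_polys \<Longrightarrow> f \<in> polyfuns"
proof -
  assume "f \<in> affine_polys"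
  then obtain a b where "\<forall>x. f x = a + (\<Sum>i\<in>UNIV. b $ i * of_real (x $ i))"
    unfolding affine_polys_def by blast
  then have "f = (\<lambda>x. a + (\<Sum>i\<in>UNIV. b $ i * of_real (x $ i)))" by auto
  also have "\<dots> \<in> polyfuns" by (intro polyfuns_sum polyfuns.intros)
  finally show ?thesis .
qed

lemma quadratic_polyfuns:
  fixes f :: "real^'n::finite \<Rightarrow> complex"
  shows "f \<in> quadratic_polys \<Longrightarrow> f \<in> polyfuns"
proof -
  assume "f \<in> quadratic_polys"
  then obtain a b and M :: "complex^'n^'n" where
    "\<forall>x. f x = a + (\<Sum>i\<in>UNIV. b $ i * of_real (x $ i))
             + (\<Sum>i\<in>UNIV. \<Sum>j\<in>UNIV. M $ i $ j * of_real (x $ i) * of_real (x $ j))"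
    unfolding quadratic_polys_def by blast
  then have "f = (\<lambda>x. a + (\<Sum>i\<in>UNIV. b $ i * of_real (x $ i))
             + (\<Sum>i\<in>UNIV. \<Sum>j\<in>UNIV. M $ i $ j * of_real (x $ i) * of_real (x $ j)))"
    by auto
  also have "\<dots> \<in> polyfuns" by (intro polyfuns_sum polyfuns.intros)
  finally show ?thesis .
qed

lemma polyfuns_derivative:
  assumes "f \<in> polyfuns"
  shows "\<exists>D. (\<forall>v. (\<lambda>x. D x v) \<in> polyfuns) \<and> (\<forall>x. (f has_derivative D x) (at x))"
  using assms
proof induction
  case (const c)
  show ?case by (intro exI[of _ "\<lambda>x v. 0"]) (auto intro: polyfuns.intros)
next
  case (coord i)
  show ?case
    by (intro exI[of _ "\<lambda>x v. of_real (v $ i)"])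
       (auto intro!: polyfuns.intros bounded_linear_imp_has_derivative
         bounded_linear_compose[OF bounded_linear_of_real bounded_linear_vec_nth])
next
  case (add f g)
  then obtain D D' where "\<forall>v. (\<lambda>x. D x v) \<in> polyfuns" "\<forall>x. (f has_derivative D x) (at x)"
    "\<forall>v. (\<lambda>x. D' x v) \<in> polyfuns" "\<forall>x. (g has_derivative D' x) (at x)" by blast
  then show ?case
    by (intro exI[of _ "\<lambda>x v. D x v + D' x v"]) (auto intro!: polyfuns.intros has_derivative_add)
next
  case (mult f g)
  then obtain D D' where "\<forall>v. (\<lambda>x. D x v) \<in> polyfuns" "\<forall>x. (f has_derivative D x) (at x)"
    "\<forall>v. (\<lambda>x. D' x v) \<in> polyfuns" "\<forall>x. (g has_derivative D' x) (at x)" by blast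
  then show ?case using mult.hyps
    by (intro exI[of _ "\<lambda>x v. f x * D' x v + D x v * g x"])
       (auto intro!: polyfuns.intros has_derivative_mult)
qed

lemma polyfuns_measurable: "f \<in> polyfuns \<Longrightarrow> f \<in> borel_measurable lborel"
proof -
  assume "f \<in> polyfuns"
  then have "continuous_on UNIV f"
    using polyfuns_derivative has_derivative_continuous
    by (metis continuous_at_imp_continuous_on)
  then show ?thesis by (simp add: borel_measurable_continuous_onI)
qed

text \<open>Asking for every rate \<open>\<delta>\<close> makes the notion stable under products, as
  the rate can be halved between the factors, and lets a Gaussian of any width absorb the function.
  The centre \<open>q\<close> is that of the Gaussian to be compared with.\<close>

definition subgaussian_growth :: "'a::euclidean_space \<Rightarrow> ('a \<Rightarrow> 'b::real_normed_div_algebra) \<Rightarrow> bool" where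
  "subgaussian_growth q f \<longleftrightarrow> (\<forall>\<delta>>0. \<exists>K. \<forall>x. norm (f x) \<le> K * exp (\<delta> * (norm (x - q))\<^sup>2))"

lemma subgaussian_growth_mono:
  assumes "subgaussian_growth q g" "\<And>x. norm (f x) \<le> norm (g x)"
  shows "subgaussian_growth q f"
  using assms unfolding subgaussian_growth_def by (meson order_trans)

lemma subgaussian_growth_const: "subgaussian_growth q (\<lambda>x. c)"
  unfolding subgaussian_growth_def
proof (intro allI impI exI[of _ "norm c"])
  fix \<delta> :: real and x assume "\<delta> > 0"
  then have "1 \<le> exp (\<delta> * (norm (x - q))\<^sup>2)" by simp
  then show "norm c \<le> norm c * exp (\<delta> * (norm (x - q))\<^sup>2)" by (simp add: mult_le_cancel_left1)
qed

text \<open>With \<open>y\<close> the distance to \<open>q\<close>, the linear term is traded for a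
  square by \<open>y \<le> 1 + y^2\<close>, and \<open>\<delta> * y^2\<close> is below its
  exponential; hence the \<open>1 / \<delta>\<close> in the constant.\<close>

lemma subgaussian_growth_norm: "subgaussian_growth q (norm :: 'a::euclidean_space \<Rightarrow> real)"
  unfolding subgaussian_growth_def
proof (intro allI impI)
  fix \<delta> :: real assume "\<delta> > 0"
  show "\<exists>K. \<forall>x. norm (norm x) \<le> K * exp (\<delta> * (norm (x - q))\<^sup>2)"
  proof (intro exI allI)
    fix x
    let ?y = "norm (x - q)" and ?e = "exp (\<delta> * (norm (x - q))\<^sup>2)"
    have "norm x \<le> ?y + norm q" using norm_triangle_ineq[of "x - q" q] by simp
    also have "?y \<le> 1 + ?y\<^sup>2"
    proof -
      have "2 * ?y \<le> 1 + ?y\<^sup>2" using sum_squares_bound[of 1 ?y] by simp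
      then show ?thesis using norm_ge_zero[of "x - q"] by linarith
    qed
    also have "?y\<^sup>2 = \<delta> * ?y\<^sup>2 / \<delta>" using \<open>\<delta> > 0\<close> by simp
    also have "\<dots> \<le> ?e / \<delta>"
      using exp_ge_add_one_self[of "\<delta> * ?y\<^sup>2"] \<open>\<delta> > 0\<close> by (intro divide_right_mono) linarith+
    finally have "norm x \<le> (1 + norm q) * 1 + ?e / \<delta>" by simp
    also have "\<dots> \<le> (1 + norm q) * ?e + ?e / \<delta>"
      using \<open>\<delta> > 0\<close> by (intro add_right_mono mult_left_mono) auto
    finally show "norm (norm x) \<le> (1 + norm q + 1 / \<delta>) * ?e" by (simp add: algebra_simps)
  qed
qed

lemma subgaussian_growth_add:
  assumes "subgaussian_growth q f" "subgaussian_growth q g"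
  shows "subgaussian_growth q (\<lambda>x. f x + g x)"
  unfolding subgaussian_growth_def
proof (intro allI impI)
  fix \<delta> :: real assume "\<delta> > 0"
  then obtain K K' where "\<forall>x. norm (f x) \<le> K * exp (\<delta> * (norm (x - q))\<^sup>2)"
     "\<forall>x. norm (g x) \<le> K' * exp (\<delta> * (norm (x - q))\<^sup>2)"
    using assms unfolding subgaussian_growth_def by blast
  then have "norm (f x + g x) \<le> (K + K') * exp (\<delta> * (norm (x - q))\<^sup>2)" for x
    using norm_triangle_ineq[of "f x" "g x"] by (simp add: distrib_right add_mono order_trans)
  then show "\<exists>K. \<forall>x. norm (f x + g x) \<le> K * exp (\<delta> * (norm (x - q))\<^sup>2)" by blast
qed

lemma subgaussian_growth_mult:
  assumes "subgaussian_growth q f" "subgaussian_growth q g"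
  shows "subgaussian_growth q (\<lambda>x. f x * g x)"
  unfolding subgaussian_growth_def
proof (intro allI impI)
  fix \<delta> :: real assume "\<delta> > 0"
  then have "\<delta> / 2 > 0" by simp
  then obtain K K' where K: "\<forall>x. norm (f x) \<le> K * exp (\<delta> / 2 * (norm (x - q))\<^sup>2)"
     "\<forall>x. norm (g x) \<le> K' * exp (\<delta> / 2 * (norm (x - q))\<^sup>2)"
    using assms unfolding subgaussian_growth_def by blast
  have "norm (f x * g x) \<le> (K * K') * exp (\<delta> * (norm (x - q))\<^sup>2)" for x
  proof -
    let ?e = "exp (\<delta> / 2 * (norm (x - q))\<^sup>2)"
    have "norm (f x * g x) \<le> (K * ?e) * (K' * ?e)"
      unfolding norm_mult using K by (intro mult_mono) (auto intro: order_trans[OF norm_ge_zero])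
    also have "\<dots> = (K * K') * (?e * ?e)" by simp
    also have "?e * ?e = exp (\<delta> * (norm (x - q))\<^sup>2)" by (simp flip: exp_add)
    finally show ?thesis .
  qed
  then show "\<exists>K. \<forall>x. norm (f x * g x) \<le> K * exp (\<delta> * (norm (x - q))\<^sup>2)" by blast
qed

lemma subgaussian_growth_power:
  "subgaussian_growth q f \<Longrightarrow> subgaussian_growth q (\<lambda>x. f x ^ k)"
  by (induction k) (auto intro: subgaussian_growth_const subgaussian_growth_mult)

lemma polyfuns_subgaussian_growth: "f \<in> polyfuns \<Longrightarrow> subgaussian_growth q f"
proof (induction rule: polyfuns.induct)
  case (coord i)
  show ?case
    unfolding subgaussian_growth_def
  proof (intro allI impI)
    fix \<delta> :: real assume "\<delta> > 0"
    then obtain K where "\<forall>x. norm x \<le> K * exp (\<delta> * (norm (x - q))\<^sup>2)"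
      using subgaussian_growth_norm[of q] unfolding subgaussian_growth_def by auto
    then have "\<forall>x. norm (complex_of_real (x $ i)) \<le> K * exp (\<delta> * (norm (x - q))\<^sup>2)"
      using component_le_norm_cart by (metis norm_of_real order_trans)
    then show "\<exists>K. \<forall>x. norm (complex_of_real (x $ i)) \<le> K * exp (\<delta> * (norm (x - q))\<^sup>2)"
      by blast
  qed
qed (auto intro: subgaussian_growth_const subgaussian_growth_add subgaussian_growth_mult)

section \<open>Gaussian wave packets\<close>

lemma integral_lborel_affine:
  fixes F :: "'a::euclidean_space \<Rightarrow> real"
  assumes "integrable lborel F" "c \<noteq> 0"
  shows "integrable lborel (\<lambda>x. F (t + c *\<^sub>R x))"
    and "(LINT x|lborel. F (t + c *\<^sub>R x)) = (LINT x|lborel. F x) / \<bar>c\<bar> ^ DIM('a)"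
proof -
  have F[measurable]: "F \<in> borel_measurable borel"
    using borel_measurable_integrable[OF assms(1)] by simp
  have lb: "lborel = density (distr lborel borel (\<lambda>x. t + c *\<^sub>R x)) (\<lambda>_. ennreal (\<bar>c\<bar> ^ DIM('a)))"
    using lborel_affine[OF assms(2), of t] by (simp add: ennreal_power)
  have pos: "\<bar>c\<bar> ^ DIM('a) > 0" using assms(2) by simp
  have "integrable (density (distr lborel borel (\<lambda>x. t + c *\<^sub>R x)) (\<lambda>_. ennreal (\<bar>c\<bar> ^ DIM('a)))) F"
    using assms(1) lb by simp
  then show "integrable lborel (\<lambda>x. F (t + c *\<^sub>R x))"
    using pos assms(2) by (subst (asm) integrable_density) (simp_all add: integrable_distr_eq)
  have "(LINT x|lborel. F x) = integral\<^sup>L (density (distr lborel borel (\<lambda>x. t + c *\<^sub>R x))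
            (\<lambda>_. ennreal (\<bar>c\<bar> ^ DIM('a)))) F"
    using lb by simp
  also have "\<dots> = \<bar>c\<bar> ^ DIM('a) * (LINT x|lborel. F (t + c *\<^sub>R x))"
    using pos by (subst integral_density) (simp_all add: integral_distr)
  finally show "(LINT x|lborel. F (t + c *\<^sub>R x)) = (LINT x|lborel. F x) / \<bar>c\<bar> ^ DIM('a)"
    using pos by (simp add: field_simps)
qed

lemma cmod_gaussian:
  assumes "\<epsilon> > 0"
  shows "cmod (gaussian \<epsilon> q p C \<zeta> x) =
    exp (- ((x - q) \<bullet> (Im_matrix C *v (x - q)) / 2 + Im \<zeta>) / \<epsilon>)"
proof -
  define z where "z = (1 / 2) * (\<Sum>i\<in>UNIV. \<Sum>j\<in>UNIV. of_real ((x - q) $ i) * C $ i $ j * of_real ((x - q) $ j))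
        + of_real ((x - q) \<bullet> p) + \<zeta>"
  have "(\<Sum>i\<in>UNIV. \<Sum>j\<in>UNIV. (x - q) $ i * Im (C $ i $ j) * (x - q) $ j) =
        (x - q) \<bullet> (Im_matrix C *v (x - q))"
    unfolding inner_vec_def matrix_vector_mult_def Im_matrix_def
    by (simp add: sum_distrib_left mult_ac)
  then have "Im z = (x - q) \<bullet> (Im_matrix C *v (x - q)) / 2 + Im \<zeta>"
    unfolding z_def by (simp add: Im_sum del: vector_minus_component)
  moreover have "Re (\<i> / of_real \<epsilon> * z) = - Im z / \<epsilon>"
  proof -
    have "\<i> / of_real \<epsilon> * z = (\<i> * z) / of_real \<epsilon>" by simp
    then show ?thesis by (simp only: Re_divide_of_real) simp
  qed
  ultimately show ?thesis
    unfolding gaussian_def z_def[symmetric] by simp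
qed

text \<open>The weight costs half of the Gaussian exponent, and halving that exponent is the dilation
  \<open>x \<mapsto> q + (x - q) / sqrt 2\<close>, so no Gaussian integral has to be evaluated.\<close>

lemma gaussian_weight_L2:
  fixes q p :: "real^'n::finite" and C :: "complex^'n^'n" and \<zeta> :: complex and \<epsilon> :: real
  defines "g \<equiv> gaussian \<epsilon> q p C \<zeta>"
  assumes "\<epsilon> > 0" "g \<in> L2" and \<rho>: "\<And>y. \<rho> * (norm y)\<^sup>2 \<le> y \<bullet> (Im_matrix C *v y)"
    and f: "f \<in> borel_measurable lborel"
    and f_le: "\<And>x. (cmod (f x))\<^sup>2 \<le> K * exp (\<rho> * (norm (x - q))\<^sup>2 / (2 * \<epsilon>))"
  shows "(\<lambda>x. f x * g x) \<in> L2"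
    and "(L2_norm (\<lambda>x. f x * g x))\<^sup>2 \<le> K * sqrt 2 ^ CARD('n) * (L2_norm g)\<^sup>2"
proof -
  define Q where "Q y = y \<bullet> (Im_matrix C *v y)" for y
  define c :: real where "c = 1 / sqrt 2"
  define G where "G x = (cmod (g x))\<^sup>2" for x
  have G: "G x = exp (- (Q (x - q) + 2 * Im \<zeta>) / \<epsilon>)" for x
    unfolding G_def g_def cmod_gaussian[OF \<open>\<epsilon> > 0\<close>] Q_def[symmetric] exp_double[symmetric]
    using \<open>\<epsilon> > 0\<close> by (simp add: field_simps)
  have Q_scale: "Q (c *\<^sub>R y) = Q y / 2" for y
  proof -
    have "Q (c *\<^sub>R y) = (c * c) * Q y" by (simp add: Q_def matrix_vector_mult_scaleR)
    then show ?thesis by (simp add: c_def)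
  qed
  have "K \<ge> 0"
    using order_trans[OF zero_le_power2 f_le[of q]] by simp
  have le: "(cmod (f x * g x))\<^sup>2 \<le> K * G ((q - c *\<^sub>R q) + c *\<^sub>R x)" for x
  proof -
    have "(cmod (f x * g x))\<^sup>2 = (cmod (f x))\<^sup>2 * G x"
      by (simp add: G_def norm_mult power_mult_distrib)
    also have "\<dots> \<le> (K * exp (\<rho> * (norm (x - q))\<^sup>2 / (2 * \<epsilon>))) * G x"
      by (intro mult_right_mono f_le) (simp add: G_def)
    also have "\<dots> = K * exp (\<rho> * (norm (x - q))\<^sup>2 / (2 * \<epsilon>) + - (Q (x - q) + 2 * Im \<zeta>) / \<epsilon>)"
      unfolding G exp_add by simp
    also have "\<dots> \<le> K * exp (- (Q (x - q) / 2 + 2 * Im \<zeta>) / \<epsilon>)"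
    proof -
      have "\<rho> * (norm (x - q))\<^sup>2 / (2 * \<epsilon>) \<le> Q (x - q) / (2 * \<epsilon>)"
        using \<rho>[of "x - q"] \<open>\<epsilon> > 0\<close> by (intro divide_right_mono) (auto simp: Q_def)
      then have "\<rho> * (norm (x - q))\<^sup>2 / (2 * \<epsilon>) + - (Q (x - q) + 2 * Im \<zeta>) / \<epsilon> \<le>
          - (Q (x - q) / 2 + 2 * Im \<zeta>) / \<epsilon>"
        using \<open>\<epsilon> > 0\<close> by (simp add: field_simps)
      then show ?thesis using \<open>K \<ge> 0\<close> by (intro mult_left_mono) auto
    qed
    \<comment> \<open>The dilation affects only the quadratic form; the constant with
      \<open>Im \<zeta>\<close> survives, so the bound is relative to the norm of \<open>g\<close>
      itself.\<close>
    also have "\<dots> = K * G ((q - c *\<^sub>R q) + c *\<^sub>R x)"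
    proof -
      have "(q - c *\<^sub>R q) + c *\<^sub>R x - q = c *\<^sub>R (x - q)" by (simp add: algebra_simps)
      then show ?thesis unfolding G by (simp only: Q_scale)
    qed
    finally show ?thesis .
  qed
  have c: "c \<noteq> 0" by (simp add: c_def)
  have intG: "integrable lborel G" unfolding G_def by (rule L2_sq_integrable[OF assms(3)])
  have int: "integrable lborel (\<lambda>x. K * G ((q - c *\<^sub>R q) + c *\<^sub>R x))"
    by (intro integrable_mult_right integral_lborel_affine(1) intG c)
  show L: "(\<lambda>x. f x * g x) \<in> L2"
  proof (rule L2_dominated[OF _ int le])
    show "(\<lambda>x. f x * g x) \<in> borel_measurable lborel"
      using f L2_measurable[OF assms(3)] by simp
  qed
  have "(L2_norm (\<lambda>x. f x * g x))\<^sup>2 \<le> (LINT x|lborel. K * G ((q - c *\<^sub>R q) + c *\<^sub>R x))"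
    unfolding L2_norm_sq by (intro integral_mono L2_sq_integrable[OF L] int le)
  also have "\<dots> = K * ((LINT x|lborel. G x) / \<bar>c\<bar> ^ DIM(real^'n))"
    by (simp add: integral_lborel_affine(2)[OF intG c])
  also have "\<dots> = K * sqrt 2 ^ CARD('n) * (L2_norm g)\<^sup>2"
    by (simp add: L2_norm_sq G_def c_def power_one_over)
  finally show "(L2_norm (\<lambda>x. f x * g x))\<^sup>2 \<le> K * sqrt 2 ^ CARD('n) * (L2_norm g)\<^sup>2" .
qed

text \<open>The rate \<open>\<rho> / (2 * \<epsilon>)\<close> that \<open>gaussian_weight_L2\<close>
  tolerates for the squared factor is one admissible \<open>\<delta>\<close>.\<close>

lemma subgaussian_gaussian_L2:
  fixes q :: "real^'n::finite"
  assumes "\<epsilon> > 0" "\<rho> > 0" "gaussian \<epsilon> q p C \<zeta> \<in> L2"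
    and "\<And>y. \<rho> * (norm y)\<^sup>2 \<le> y \<bullet> (Im_matrix C *v y)"
    and "f \<in> borel_measurable lborel" "subgaussian_growth q f"
  shows "(\<lambda>x. f x * gaussian \<epsilon> q p C \<zeta> x) \<in> L2"
proof -
  have "\<rho> / (2 * \<epsilon>) > 0" using assms by simp
  then obtain K where K: "\<And>x. norm ((f x)\<^sup>2) \<le> K * exp (\<rho> / (2 * \<epsilon>) * (norm (x - q))\<^sup>2)"
    using subgaussian_growth_power[OF assms(6), of 2] unfolding subgaussian_growth_def by blast
  then have "(cmod (f x))\<^sup>2 \<le> K * exp (\<rho> * (norm (x - q))\<^sup>2 / (2 * \<epsilon>))" for x
    by (simp add: norm_power)
  with assms show ?thesis by (intro gaussian_weight_L2(1)) auto
qed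

section \<open>Derivatives of Gaussians\<close>

text \<open>Component \<open>i\<close> of \<open>C (x - q) + p\<close>. For symmetric
  \<open>C\<close> this is the gradient of the phase; the logarithmic gradient of the Gaussian is
  \<open>\<i> / \<epsilon>\<close> times it.\<close>

definition log_gradient ::
  "real^'n::finite \<Rightarrow> real^'n \<Rightarrow> complex^'n^'n \<Rightarrow> 'n \<Rightarrow> real^'n \<Rightarrow> complex" where
  "log_gradient q p C i x = (\<Sum>j\<in>UNIV. C $ i $ j * of_real ((x - q) $ j)) + of_real (p $ i)"

lemma gaussian_has_derivative:
  assumes "transpose C = C"
  shows "(gaussian \<epsilon> q p C \<zeta> has_derivative
    (\<lambda>v. \<i> / of_real \<epsilon> * (\<Sum>i\<in>UNIV. log_gradient q p C i x * of_real (v $ i)) *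
      gaussian \<epsilon> q p C \<zeta> x)) (at x)"
proof -
  have sym: "C $ i $ j = C $ j $ i" for i j
    using arg_cong[OF assms, of "\<lambda>M. M $ i $ j"] by (simp add: transpose_def)
  have comp: "((\<lambda>x. complex_of_real ((x - q) $ i)) has_derivative (\<lambda>v. of_real (v $ i))) (at x)" for i
    by (auto intro!: derivative_eq_intros bounded_linear.has_derivative[OF bounded_linear_vec_nth])
  have inn: "((\<lambda>x. complex_of_real ((x - q) \<bullet> p)) has_derivative (\<lambda>v. of_real (v \<bullet> p))) (at x)"
    by (auto intro!: derivative_eq_intros)
  \<comment> \<open>The derivative of the phase as the product rule delivers it; by symmetry of
    \<open>C\<close> both double sums agree, which uses up the factor 1/2.\<close>
  let ?S = "\<lambda>v. (1 / 2) * (\<Sum>i\<in>UNIV. \<Sum>j\<in>UNIV.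
      of_real ((x - q) $ i) * C $ i $ j * of_real (v $ j) +
      of_real (v $ i) * C $ i $ j * of_real ((x - q) $ j)) + of_real (v \<bullet> p)"
  have S: "?S v = (\<Sum>i\<in>UNIV. log_gradient q p C i x * of_real (v $ i))" for v
  proof -
    have "(\<Sum>i\<in>UNIV. \<Sum>j\<in>UNIV. of_real ((x - q) $ i) * C $ i $ j * of_real (v $ j)) =
          (\<Sum>i\<in>UNIV. \<Sum>j\<in>UNIV. of_real (v $ i) * C $ i $ j * of_real ((x - q) $ j))"
      by (subst sum.swap) (simp add: sym mult_ac)
    then have "?S v = (\<Sum>i\<in>UNIV. \<Sum>j\<in>UNIV. of_real (v $ i) * C $ i $ j * of_real ((x - q) $ j))
        + of_real (v \<bullet> p)"
      unfolding sum.distrib by simp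
    also have "\<dots> = (\<Sum>i\<in>UNIV. log_gradient q p C i x * of_real (v $ i))"
      by (simp only: log_gradient_def inner_vec_def distrib_right sum.distrib sum_distrib_right)
         (simp add: mult_ac)
    finally show ?thesis .
  qed
  have "((\<lambda>x. \<i> / of_real \<epsilon> * ((1 / 2) * (\<Sum>i\<in>UNIV. \<Sum>j\<in>UNIV.
          of_real ((x - q) $ i) * C $ i $ j * of_real ((x - q) $ j)) + of_real ((x - q) \<bullet> p) + \<zeta>))
        has_derivative (\<lambda>v. \<i> / of_real \<epsilon> * (?S v + 0))) (at x)"
  proof (rule has_derivative_mult_right, rule has_derivative_add[OF has_derivative_add[OF _ inn] has_derivative_const],
      rule has_derivative_mult_right, rule has_derivative_sum, rule has_derivative_sum)
    fix i j
    show "((\<lambda>x. complex_of_real ((x - q) $ i) * C $ i $ j * of_real ((x - q) $ j)) has_derivative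
      (\<lambda>v. of_real ((x - q) $ i) * C $ i $ j * of_real (v $ j) +
        of_real (v $ i) * C $ i $ j * of_real ((x - q) $ j))) (at x)"
      by (rule has_derivative_mult[OF has_derivative_mult_left[OF comp] comp])
  qed
  note E = has_derivative_compose[OF this has_field_derivative_imp_has_derivative[OF DERIV_exp]]
  have g: "gaussian \<epsilon> q p C \<zeta> = (\<lambda>x. exp (\<i> / of_real \<epsilon> * ((1 / 2) * (\<Sum>i\<in>UNIV. \<Sum>j\<in>UNIV.
      of_real ((x - q) $ i) * C $ i $ j * of_real ((x - q) $ j)) + of_real ((x - q) \<bullet> p) + \<zeta>)))"
    by (rule ext) (rule gaussian_def)
  show ?thesis
    unfolding g using E unfolding S by (simp only: add_0_right mult.commute)
qed

lemma affine_log_gradient: "log_gradient q p C i \<in> affine_polys"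
  unfolding log_gradient_def
  by (intro affine_add affine_sum affine_scale affine_shifted_coord affine_const)

lemma polyfun_gaussian_derivative:
  assumes "transpose C = C" "f \<in> polyfuns"
  obtains D where "\<And>v. (\<lambda>x. D v x) \<in> polyfuns"
    "\<And>x. ((\<lambda>x. f x * gaussian \<epsilon> q p C \<zeta> x) has_derivative (\<lambda>v. D v x * gaussian \<epsilon> q p C \<zeta> x)) (at x)"
proof -
  obtain D where D: "\<And>v. (\<lambda>x. D x v) \<in> polyfuns" "\<And>x. (f has_derivative D x) (at x)"
    using polyfuns_derivative[OF assms(2)] by blast
  let ?E = "\<lambda>v x. f x * (\<i> / of_real \<epsilon> * (\<Sum>i\<in>UNIV. log_gradient q p C i x * of_real (v $ i))) + D x v"
  show ?thesis
  proof
    show "?E v \<in> polyfuns" for v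
      by (intro polyfuns.intros polyfuns_sum assms(2) D(1) affine_polyfuns affine_log_gradient)
    show "((\<lambda>x. f x * gaussian \<epsilon> q p C \<zeta> x) has_derivative (\<lambda>v. ?E v x * gaussian \<epsilon> q p C \<zeta> x)) (at x)" for x
      using has_derivative_mult[OF D(2) gaussian_has_derivative[OF assms(1)]]
      by (simp add: distrib_right mult.assoc)
  qed
qed

text \<open>Polynomial multiples of one fixed Gaussian are stable under differentiation, since the
  Gaussian contributes just an affine factor.\<close>

lemma polyfun_gaussian_iter_deriv:
  assumes "transpose C = C" "f \<in> polyfuns"
  shows "\<exists>h\<in>polyfuns. iter_deriv vs (\<lambda>x. f x * gaussian \<epsilon> q p C \<zeta> x) = (\<lambda>x. h x * gaussian \<epsilon> q p C \<zeta> x)"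
proof (induction vs)
  case (Cons v vs)
  then obtain h where h: "h \<in> polyfuns"
    and eq: "iter_deriv vs (\<lambda>x. f x * gaussian \<epsilon> q p C \<zeta> x) = (\<lambda>x. h x * gaussian \<epsilon> q p C \<zeta> x)" by blast
  obtain D where D: "\<And>v. (\<lambda>x. D v x) \<in> polyfuns"
    "\<And>x. ((\<lambda>x. h x * gaussian \<epsilon> q p C \<zeta> x) has_derivative (\<lambda>v. D v x * gaussian \<epsilon> q p C \<zeta> x)) (at x)"
    using polyfun_gaussian_derivative[OF assms(1) h] by blast
  show ?case
    using D(1)[of v] by (intro bexI[of _ "D v"]) (auto simp: eq frechet_derivative_at[OF D(2), symmetric])
qed (use assms(2) in auto)

text \<open>This makes the wave packet admissible data for \<open>generated_by_hamiltonian\<close>.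
  Every weighted derivative is a subgaussian factor times the Gaussian.\<close>

lemma schwartz_gaussian:
  assumes "transpose C = C" "\<epsilon> > 0" "\<rho> > 0"
    and \<rho>: "\<And>y. \<rho> * (norm y)\<^sup>2 \<le> y \<bullet> (Im_matrix C *v y)"
  shows "schwartz (gaussian \<epsilon> q p C \<zeta>)"
proof -
  let ?g = "gaussian \<epsilon> q p C \<zeta>"
  have ex: "\<exists>h\<in>polyfuns. iter_deriv vs ?g = (\<lambda>x. h x * ?g x)" for vs
    using polyfun_gaussian_iter_deriv[OF assms(1) polyfuns.const[of 1], of vs \<epsilon> q p \<zeta>] by simp
  have "iter_deriv vs ?g differentiable (at x)" for vs x
  proof -
    obtain h where h: "h \<in> polyfuns" "iter_deriv vs ?g = (\<lambda>x. h x * ?g x)" using ex by blast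
    obtain D where "\<And>x. ((\<lambda>x. h x * ?g x) has_derivative (\<lambda>v. D v x * ?g x)) (at x)"
      using polyfun_gaussian_derivative[OF assms(1) h(1)] by blast
    then show ?thesis unfolding h(2) differentiable_def by blast
  qed
  moreover have "\<exists>B. \<forall>x. norm x ^ k * cmod (iter_deriv vs ?g x) \<le> B" for k vs
  proof -
    obtain h where h: "h \<in> polyfuns" "iter_deriv vs ?g = (\<lambda>x. h x * ?g x)" using ex by blast
    have "subgaussian_growth q (\<lambda>x. norm x ^ k * cmod (h x))"
      by (intro subgaussian_growth_mult subgaussian_growth_power subgaussian_growth_norm
          subgaussian_growth_mono[OF polyfuns_subgaussian_growth[OF h(1)]]) simp
    \<comment> \<open>The rate equals that of the guaranteed decay of the modulus of the Gaussian,
      so growth and decay cancel and only the \<open>\<zeta>\<close> factor remains.\<close>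
    moreover have "\<rho> / (2 * \<epsilon>) > 0" using assms by simp
    ultimately obtain K where
      K: "\<And>x. norm (norm x ^ k * cmod (h x)) \<le> K * exp (\<rho> / (2 * \<epsilon>) * (norm (x - q))\<^sup>2)"
      unfolding subgaussian_growth_def by blast
    have "norm x ^ k * cmod (iter_deriv vs ?g x) \<le> K * exp (- Im \<zeta> / \<epsilon>)" for x
    proof -
      have "K \<ge> 0" using order_trans[OF norm_ge_zero K[of q]] by simp
      have "norm x ^ k * cmod (iter_deriv vs ?g x) = (norm x ^ k * cmod (h x)) * cmod (?g x)"
        by (simp add: h(2) norm_mult)
      also have "\<dots> \<le> (K * exp (\<rho> / (2 * \<epsilon>) * (norm (x - q))\<^sup>2)) * cmod (?g x)"
        using K[of x] by (intro mult_right_mono) auto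
      also have "\<dots> = K * exp (\<rho> / (2 * \<epsilon>) * (norm (x - q))\<^sup>2 +
          - ((x - q) \<bullet> (Im_matrix C *v (x - q)) / 2 + Im \<zeta>) / \<epsilon>)"
        unfolding cmod_gaussian[OF \<open>\<epsilon> > 0\<close>] exp_add by simp
      also have "\<dots> \<le> K * exp (- Im \<zeta> / \<epsilon>)"
      proof -
        have "\<rho> / (2 * \<epsilon>) * (norm (x - q))\<^sup>2 +
            - ((x - q) \<bullet> (Im_matrix C *v (x - q)) / 2 + Im \<zeta>) / \<epsilon> \<le> - Im \<zeta> / \<epsilon>"
          using \<rho>[of "x - q"] \<open>\<epsilon> > 0\<close> by (simp add: field_simps)
        then show ?thesis using \<open>K \<ge> 0\<close> by (intro mult_left_mono) auto
      qed
      finally show ?thesis .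
    qed
    then show ?thesis by blast
  qed
  ultimately show ?thesis unfolding schwartz_def smooth_def by blast
qed

section \<open>Taylor expansion\<close>

text \<open>Smoothness is assumed jointly in time and space while the bounds concern spatial
  derivatives; the link is that a spatial direction \<open>v\<close> is the joint direction
  \<open>(0, v)\<close>.\<close>

lemma iter_deriv_slice:
  fixes F :: "real \<Rightarrow> 'a::euclidean_space \<Rightarrow> 'b::real_normed_vector"
  assumes "smooth (\<lambda>(t, x). F t x)"
  shows "iter_deriv vs (F t) x = iter_deriv (map (Pair 0) vs) (\<lambda>(t, x). F t x) (t, x)"
    and "iter_deriv vs (F t) differentiable (at x)"
proof -
  let ?G = "\<lambda>(t, x). F t x"
  have chain: "((\<lambda>x. iter_deriv vs ?G (t, x)) has_derivative
      (\<lambda>v. frechet_derivative (iter_deriv vs ?G) (at (t, x)) (0, v))) (at x)" for vs x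
  proof (rule has_derivative_compose[where f = "Pair t"])
    show "(Pair t has_derivative Pair 0) (at x)"
      by (auto intro!: derivative_eq_intros)
    show "(iter_deriv vs ?G has_derivative frechet_derivative (iter_deriv vs ?G) (at (t, x))) (at (t, x))"
      using assms unfolding smooth_def frechet_derivative_works by blast
  qed
  have eq: "iter_deriv vs (F t) = (\<lambda>x. iter_deriv (map (Pair 0) vs) ?G (t, x))" for vs
  proof (induction vs)
    case (Cons v vs)
    then show ?case by (auto simp: frechet_derivative_at[OF chain, symmetric])
  qed simp
  show "iter_deriv vs (F t) x = iter_deriv (map (Pair 0) vs) ?G (t, x)" by (simp add: eq)
  show "iter_deriv vs (F t) differentiable (at x)"
    unfolding eq differentiable_def using chain by blast
qed

lemma smooth_slice:
  fixes F :: "real \<Rightarrow> 'a::euclidean_space \<Rightarrow> 'b::real_normed_vector"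
  shows "smooth (\<lambda>(t, x). F t x) \<Longrightarrow> smooth (F t)"
  unfolding smooth_def[of "F t"] by (simp add: iter_deriv_slice(2))

lemma smooth_has_derivative:
  "smooth f \<Longrightarrow> (iter_deriv vs f has_derivative (\<lambda>v. iter_deriv (v # vs) f x)) (at x)"
  unfolding smooth_def by (simp add: frechet_derivative_works[symmetric])

lemma iter_deriv_component:
  fixes f :: "'a::euclidean_space \<Rightarrow> real^'n::finite"
  assumes "smooth f"
  shows "iter_deriv vs (\<lambda>x. f x $ j) = (\<lambda>x. iter_deriv vs f x $ j)"
proof (induction vs)
  case (Cons v vs)
  have D: "((\<lambda>x. iter_deriv vs f x $ j) has_derivative (\<lambda>v. iter_deriv (v # vs) f x $ j)) (at x)" for x
    by (rule bounded_linear.has_derivative[OF bounded_linear_vec_nth smooth_has_derivative[OF assms]])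
  show ?case
    by (auto simp: Cons frechet_derivative_at[OF D, symmetric])
qed simp

lemma smooth_component:
  fixes f :: "'a::euclidean_space \<Rightarrow> real^'n::finite"
  assumes "smooth f" shows "smooth (\<lambda>x. f x $ j)"
  unfolding smooth_def iter_deriv_component[OF assms] differentiable_def
  using bounded_linear.has_derivative[OF bounded_linear_vec_nth smooth_has_derivative[OF assms]] by blast

lemma linear_axis_expansion:
  fixes D :: "real^'n::finite \<Rightarrow> real"
  assumes "linear D"
  shows "D y = (\<Sum>i\<in>UNIV. y $ i * D (axis i 1))"
proof -
  have "(\<Sum>i\<in>UNIV. y $ i *\<^sub>R axis i 1) = y"
    by (simp add: basis_expansion flip: scalar_mult_eq_scaleR)
  then have "D y = D (\<Sum>i\<in>UNIV. y $ i *\<^sub>R axis i 1)" by simp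
  also have "\<dots> = (\<Sum>i\<in>UNIV. y $ i * D (axis i 1))"
    by (simp add: linear_sum[OF assms] linear_cmul[OF assms])
  finally show ?thesis .
qed

text \<open>The derivative bounds are known for basis directions, so the derivative along
  \<open>y\<close> is expanded in coordinate derivatives.\<close>

lemma smooth_line_derivative:
  fixes f :: "real^'n::finite \<Rightarrow> real"
  assumes "smooth f"
  shows "((\<lambda>s. iter_deriv vs f (q + s *\<^sub>R y)) has_real_derivative
    (\<Sum>i\<in>UNIV. y $ i * iter_deriv (axis i 1 # vs) f (q + s *\<^sub>R y))) (at s)"
proof -
  let ?D = "\<lambda>v. iter_deriv (v # vs) f (q + s *\<^sub>R y)"
  have D: "(iter_deriv vs f has_derivative ?D) (at (q + s *\<^sub>R y))"
    by (rule smooth_has_derivative[OF assms])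
  have "((\<lambda>s. iter_deriv vs f (q + s *\<^sub>R y)) has_derivative (\<lambda>h. ?D (h *\<^sub>R y))) (at s)"
  proof (rule has_derivative_compose[where f = "\<lambda>s. q + s *\<^sub>R y", OF _ D])
    show "((\<lambda>s. q + s *\<^sub>R y) has_derivative (\<lambda>h. h *\<^sub>R y)) (at s)"
      by (auto intro!: derivative_eq_intros)
  qed
  moreover have "(\<lambda>h. ?D (h *\<^sub>R y)) = (*) (\<Sum>i\<in>UNIV. y $ i * ?D (axis i 1))"
  proof
    fix h
    have lin: "linear ?D" using D by (intro bounded_linear.linear has_derivative_bounded_linear)
    show "?D (h *\<^sub>R y) = (\<Sum>i\<in>UNIV. y $ i * ?D (axis i 1)) * h"
      unfolding linear_cmul[OF lin] using linear_axis_expansion[OF lin, of y]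
      by (simp only: real_scaleR_def mult.commute)
  qed
  ultimately show ?thesis unfolding has_field_derivative_def by (simp only:)
qed

lemma triple_sum_bound:
  fixes y :: "real^'n::finite"
  assumes "\<And>i j k. \<bar>a i j k\<bar> \<le> B"
  shows "\<bar>\<Sum>i\<in>UNIV. \<Sum>j\<in>UNIV. \<Sum>k\<in>UNIV. y $ i * (y $ j * (y $ k * a i j k))\<bar>
           \<le> real CARD('n) ^ 3 * B * norm y ^ 3"
proof -
  have 1: "\<bar>y $ i * (y $ j * (y $ k * a i j k))\<bar> \<le> norm y * (norm y * (norm y * B))" for i j k
    unfolding abs_mult by (intro mult_mono component_le_norm_cart assms mult_nonneg_nonneg) auto
  have "\<bar>\<Sum>i\<in>UNIV. \<Sum>j\<in>UNIV. \<Sum>k\<in>UNIV. y $ i * (y $ j * (y $ k * a i j k))\<bar>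
      \<le> (\<Sum>i\<in>(UNIV::'n set). \<Sum>j\<in>(UNIV::'n set). \<Sum>k\<in>(UNIV::'n set). norm y * (norm y * (norm y * B)))"
    by (intro order_trans[OF sum_abs] sum_mono 1)
  also have "\<dots> = real CARD('n) ^ 3 * B * norm y ^ 3"
    by (simp add: power3_eq_cube mult_ac)
  finally show ?thesis .
qed

lemma double_sum_bound:
  fixes y :: "real^'n::finite"
  assumes "\<And>i j. \<bar>a i j\<bar> \<le> B"
  shows "\<bar>\<Sum>i\<in>UNIV. \<Sum>j\<in>UNIV. y $ i * (y $ j * a i j)\<bar> \<le> real CARD('n) ^ 2 * B * norm y ^ 2"
proof -
  have 1: "\<bar>y $ i * (y $ j * a i j)\<bar> \<le> norm y * (norm y * B)" for i j
    unfolding abs_mult by (intro mult_mono component_le_norm_cart assms mult_nonneg_nonneg) auto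
  have "\<bar>\<Sum>i\<in>UNIV. \<Sum>j\<in>UNIV. y $ i * (y $ j * a i j)\<bar>
      \<le> (\<Sum>i\<in>(UNIV::'n set). \<Sum>j\<in>(UNIV::'n set). norm y * (norm y * B))"
    by (intro order_trans[OF sum_abs] sum_mono 1)
  also have "\<dots> = real CARD('n) ^ 2 * B * norm y ^ 2"
    by (simp add: power2_eq_square mult_ac)
  finally show ?thesis .
qed

definition taylor1 :: "(real^'n::finite \<Rightarrow> real) \<Rightarrow> real^'n \<Rightarrow> real^'n \<Rightarrow> real" where
  "taylor1 f q x = f q + (\<Sum>i\<in>UNIV. (x - q) $ i * iter_deriv [axis i 1] f q)"

text \<open>The head of the list is the direction differentiated last, so the lists appear in the
  order produced by repeated differentiation along a line.\<close>

definition taylor2 :: "(real^'n::finite \<Rightarrow> real) \<Rightarrow> real^'n \<Rightarrow> real^'n \<Rightarrow> real" where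
  "taylor2 f q x = taylor1 f q x + (1 / 2) *
     (\<Sum>i\<in>UNIV. \<Sum>j\<in>UNIV. (x - q) $ i * ((x - q) $ j * iter_deriv [axis j 1, axis i 1] f q))"

text \<open>On the segment from \<open>q\<close> to \<open>x\<close>, parametrised by [0, 1], the
  one-dimensional derivatives are sums of coordinate derivatives, and Maclaurin's formula leaves one
  such sum at an intermediate point. The factors 1/2 and 1/6 of the remainders are dropped.\<close>

lemma taylor_bounds:
  fixes f :: "real^'n::finite \<Rightarrow> real"
  assumes "smooth f"
  shows "(\<And>x i j. \<bar>iter_deriv [axis j 1, axis i 1] f x\<bar> \<le> B) \<Longrightarrow>
      \<bar>f x - taylor1 f q x\<bar> \<le> real CARD('n) ^ 2 * B * norm (x - q) ^ 2"
    and "(\<And>x i j k. \<bar>iter_deriv [axis k 1, axis j 1, axis i 1] f x\<bar> \<le> B) \<Longrightarrow>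
      \<bar>f x - taylor2 f q x\<bar> \<le> real CARD('n) ^ 3 * B * norm (x - q) ^ 3"
proof -
  define y where "y = x - q"
  \<comment> \<open>The last branch serves all \<open>m \<ge> 3\<close>; the derivative relation is
    claimed for \<open>m < 3\<close>, enough for Maclaurin up to order 3.\<close>
  define d where "d m = (\<lambda>s. case m of 0 \<Rightarrow> f (q + s *\<^sub>R y)
      | Suc 0 \<Rightarrow> (\<Sum>i\<in>UNIV. y $ i * iter_deriv [axis i 1] f (q + s *\<^sub>R y))
      | Suc (Suc 0) \<Rightarrow> (\<Sum>i\<in>UNIV. \<Sum>j\<in>UNIV. y $ i * (y $ j *
           iter_deriv [axis j 1, axis i 1] f (q + s *\<^sub>R y)))
      | _ \<Rightarrow> (\<Sum>i\<in>UNIV. \<Sum>j\<in>UNIV. \<Sum>k\<in>UNIV. y $ i * (y $ j * (y $ k *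
           iter_deriv [axis k 1, axis j 1, axis i 1] f (q + s *\<^sub>R y)))))" for m :: nat
  have d_deriv: "(d m has_real_derivative d (Suc m) s) (at s)" if "m < 3" for m s
  proof -
    note D = smooth_line_derivative[OF assms]
    consider "m = 0" | "m = Suc 0" | "m = Suc (Suc 0)" using \<open>m < 3\<close> by linarith
    then show ?thesis
    proof cases
      case 1
      then show ?thesis using D[of "[]" q y s] by (simp add: d_def)
    next
      case 2
      have "((\<lambda>s. \<Sum>i\<in>UNIV. y $ i * iter_deriv [axis i 1] f (q + s *\<^sub>R y)) has_real_derivative
        (\<Sum>i\<in>UNIV. y $ i * (\<Sum>j\<in>UNIV. y $ j * iter_deriv [axis j 1, axis i 1] f (q + s *\<^sub>R y)))) (at s)"
        by (intro DERIV_sum DERIV_cmult D)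
      then show ?thesis by (simp only: 2 d_def nat.case sum_distrib_left)
    next
      case 3
      have "((\<lambda>s. \<Sum>i\<in>UNIV. \<Sum>j\<in>UNIV. y $ i * (y $ j * iter_deriv [axis j 1, axis i 1] f (q + s *\<^sub>R y)))
        has_real_derivative (\<Sum>i\<in>UNIV. \<Sum>j\<in>UNIV. y $ i * (y $ j * (\<Sum>k\<in>UNIV. y $ k *
           iter_deriv [axis k 1, axis j 1, axis i 1] f (q + s *\<^sub>R y))))) (at s)"
        by (intro DERIV_sum DERIV_cmult D)
      then show ?thesis by (simp only: 3 d_def nat.case sum_distrib_left)
    qed
  qed
  have d0: "d 0 1 = f x" "d 0 0 = f q" by (simp_all add: d_def y_def)
  have mac: "\<exists>\<xi>. d 0 1 = (\<Sum>m<n. d m 0 / fact m * 1 ^ m) + d n \<xi> / fact n * 1 ^ n"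
    if "0 < n" "n \<le> 3" for n
    using Maclaurin[of 1 n d "d 0"] that d_deriv by (metis less_le_trans zero_less_one)
  show "\<bar>f x - taylor1 f q x\<bar> \<le> real CARD('n) ^ 2 * B * norm (x - q) ^ 2"
    if B: "\<And>x i j. \<bar>iter_deriv [axis j 1, axis i 1] f x\<bar> \<le> B"
  proof -
    obtain \<xi> where \<xi>: "d 0 1 = (\<Sum>m<2. d m 0 / fact m * 1 ^ m) + d 2 \<xi> / fact 2 * 1 ^ 2"
      using mac[of 2] by auto
    have "f x - taylor1 f q x = d 2 \<xi> / 2"
      using \<xi> unfolding d0 by (simp add: numeral_2_eq_2 d_def taylor1_def y_def)
    moreover have "\<bar>d 2 \<xi>\<bar> \<le> real CARD('n) ^ 2 * B * norm y ^ 2"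
      using double_sum_bound[OF B, of y] by (simp add: d_def numeral_2_eq_2)
    ultimately show ?thesis unfolding y_def by linarith
  qed
  show "\<bar>f x - taylor2 f q x\<bar> \<le> real CARD('n) ^ 3 * B * norm (x - q) ^ 3"
    if B: "\<And>x i j k. \<bar>iter_deriv [axis k 1, axis j 1, axis i 1] f x\<bar> \<le> B"
  proof -
    obtain \<xi> where \<xi>: "d 0 1 = (\<Sum>m<3. d m 0 / fact m * 1 ^ m) + d 3 \<xi> / fact 3 * 1 ^ 3"
      using mac[of 3] by auto
    have "f x - taylor2 f q x = d 3 \<xi> / 6"
      using \<xi> unfolding d0
      by (simp add: numeral_3_eq_3 d_def taylor1_def taylor2_def y_def fact_numeral del: iter_deriv.simps)
    moreover have "\<bar>d 3 \<xi>\<bar> \<le> real CARD('n) ^ 3 * B * norm y ^ 3"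
      using triple_sum_bound[OF B, of y] by (simp add: d_def numeral_3_eq_3)
    ultimately show ?thesis unfolding y_def by linarith
  qed
qed

section \<open>Rayleigh quotients\<close>

text \<open>The quadratic form attains its minimum \<open>m\<close> on the unit sphere at some
  \<open>v\<close>. Perturbing \<open>v\<close> along its residual \<open>z = M v - m v\<close>
  gives a quadratic \<open>2 s N + s^2 a\<close> that is nonnegative for all \<open>s\<close>, which
  forces \<open>z = 0\<close>; so \<open>m\<close> is an eigenvalue.\<close>

lemma symmetric_eigenvalue_lower_bound:
  fixes M :: "real^'n^'n::finite"
  assumes "transpose M = M" "\<And>l. real_eigenvalue M l \<Longrightarrow> \<rho> \<le> l"
  shows "\<rho> * (norm y)\<^sup>2 \<le> y \<bullet> (M *v y)"
proof -
  define Q where "Q v = v \<bullet> (M *v v)" for v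
  have sym: "v \<bullet> (M *v w) = w \<bullet> (M *v v)" for v w
    using dot_lmul_matrix[of v M w] vector_transpose_matrix[of v M] assms(1)
    by (simp add: inner_commute)
  have "compact (sphere 0 1 :: (real^'n) set)" "sphere 0 1 \<noteq> ({} :: (real^'n) set)"
    by auto
  moreover have "continuous_on (sphere 0 1) Q"
    unfolding Q_def by (intro continuous_intros linear_continuous_on matrix_vector_mul_bounded_linear)
  ultimately obtain v where v: "v \<in> sphere 0 1" and v_min: "\<And>w. w \<in> sphere 0 1 \<Longrightarrow> Q v \<le> Q w"
    using continuous_attains_inf[of "sphere 0 1 :: (real^'n) set" Q] by blast
  define m where "m = Q v"
  have nv: "norm v = 1" using v by simp
  have min: "m * (norm w)\<^sup>2 \<le> Q w" for w
  proof (cases "w = 0")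
    case False
    have "m \<le> Q ((1 / norm w) *\<^sub>R w)"
      unfolding m_def using False by (intro v_min) simp
    also have "\<dots> = Q w / (norm w)\<^sup>2"
      by (simp add: Q_def matrix_vector_mult_scaleR power2_eq_square)
    finally show ?thesis using False by (simp add: field_simps)
  qed (simp add: Q_def)
  define z where "z = M *v v - m *\<^sub>R v"
  define N where "N = (norm z)\<^sup>2"
  define a where "a = Q z - m * N"
  have a: "a \<ge> 0" using min[of z] by (simp add: a_def N_def)
  have quad: "0 \<le> 2 * s * N + s\<^sup>2 * a" for s
  proof -
    have Mv: "M *v v = z + m *\<^sub>R v" by (simp add: z_def)
    have zN: "z \<bullet> (M *v v) - m * (v \<bullet> z) = N"
      unfolding Mv N_def power2_norm_eq_inner by (simp add: inner_add_right inner_commute)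
    have "Q (v + s *\<^sub>R z) = m + 2 * s * (z \<bullet> (M *v v)) + s\<^sup>2 * Q z"
      using sym[of v z]
      by (simp add: m_def Q_def matrix_vector_right_distrib matrix_vector_mult_scaleR
          inner_add_left inner_add_right power2_eq_square algebra_simps)
    moreover have "(norm (v + s *\<^sub>R z))\<^sup>2 = 1 + 2 * s * (v \<bullet> z) + s\<^sup>2 * N"
      using nv unfolding N_def power2_norm_eq_inner
      by (simp add: inner_add_left inner_add_right power2_eq_square inner_commute norm_eq_1 algebra_simps)
    ultimately have "0 \<le> (m + 2 * s * (z \<bullet> (M *v v)) + s\<^sup>2 * Q z) - m * (1 + 2 * s * (v \<bullet> z) + s\<^sup>2 * N)"
      using min[of "v + s *\<^sub>R z"] by simp
    also have "\<dots> = 2 * s * (z \<bullet> (M *v v) - m * (v \<bullet> z)) + s\<^sup>2 * (Q z - m * N)"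
      by (simp add: algebra_simps)
    finally show ?thesis unfolding zN a_def .
  qed
  have "N = 0"
  proof (rule ccontr)
    assume "N \<noteq> 0"
    \<comment> \<open>The \<open>+ 1\<close> guards against \<open>a = 0\<close>. At
      \<open>s = - d\<close> the quadratic equals \<open>- d^2 (a + 2)\<close>.\<close>
    define d where "d = N / (a + 1)"
    have N: "N = d * (a + 1)" using a by (simp add: d_def)
    then have "d\<^sup>2 > 0" using \<open>N \<noteq> 0\<close> by auto
    then have "0 < d\<^sup>2 * (a + 2)" using a by simp
    moreover have "2 * (- d) * N + (- d)\<^sup>2 * a = - (d\<^sup>2 * (a + 2))"
      unfolding N by (simp add: power2_eq_square algebra_simps)
    ultimately show False using quad[of "- d"] by linarith
  qed
  then have "M *v v = m *\<^sub>R v" by (simp add: N_def z_def)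
  moreover have "v \<noteq> 0" using nv by auto
  ultimately have "\<rho> \<le> m"
    using assms(2) unfolding real_eigenvalue_def by blast
  then have "\<rho> * (norm y)\<^sup>2 \<le> m * (norm y)\<^sup>2" by (intro mult_right_mono) auto
  with min[of y] show ?thesis by (simp add: Q_def)
qed

section \<open>The Hamiltonian on Gaussian wave packets\<close>

lemma gaussian_partial:
  assumes "transpose C = C" and a: "(a has_derivative a') (at x)"
  shows "partial j (\<lambda>x. a x * gaussian \<epsilon> q p C \<zeta> x) x =
    (a' (axis j 1) + a x * (\<i> / of_real \<epsilon> * log_gradient q p C j x)) * gaussian \<epsilon> q p C \<zeta> x"
proof -
  have "(\<Sum>i\<in>UNIV. log_gradient q p C i x * of_real (axis j 1 $ i)) = log_gradient q p C j x"
    by (simp add: axis_def if_distrib[of "\<lambda>z. _ * of_real z"] if_distrib[of "\<lambda>z. _ * z"] cong: if_cong)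
  then show ?thesis
    unfolding partial_def
      frechet_derivative_at[OF has_derivative_mult[OF a gaussian_has_derivative[OF assms(1)]], symmetric]
    by (simp add: distrib_right mult.assoc)
qed

lemma admissible_smooth:
  assumes "admissible_potentials A V"
  shows "smooth (A t)" "smooth (eff_potential A V t)" "smooth (\<lambda>x. A t x $ j)"
proof -
  show "smooth (A t)" "smooth (eff_potential A V t)"
    using assms unfolding admissible_potentials_def by (auto intro: smooth_slice)
  then show "smooth (\<lambda>x. A t x $ j)" by (intro smooth_component)
qed

lemma smooth_measurable:
  fixes f :: "'a::euclidean_space \<Rightarrow> real"
  assumes "smooth f" shows "f \<in> borel_measurable lborel"
proof -
  have "continuous_on UNIV f"
    using smooth_has_derivative[OF assms, of "[]"] has_derivative_continuous
    by (metis continuous_at_imp_continuous_on iter_deriv.simps(1))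
  then show ?thesis by (simp add: borel_measurable_continuous_onI)
qed

text \<open>On the Gaussian each momentum component acts as multiplication by \<open>a j\<close>,
  the difference of \<open>A\<close> and the phase gradient; applying it again squares this factor
  and adds \<open>\<i> * \<epsilon>\<close> times its derivative. Summed up, the derivatives of
  \<open>A\<close> form its divergence and vanish, those of the phase give the trace of
  \<open>C\<close>, and the square of \<open>A\<close> joins \<open>V\<close> in
  \<open>eff_potential\<close>.\<close>

lemma hamiltonian_gaussian:
  fixes A :: "real \<Rightarrow> real^'n::finite \<Rightarrow> real^'n"
  assumes adm: "admissible_potentials A V" and "transpose C = C" "\<epsilon> > 0"
  shows "hamiltonian \<epsilon> A V t (gaussian \<epsilon> q p C \<zeta>) x =
    (- \<i> * of_real \<epsilon> / 2 * (\<Sum>j\<in>UNIV. C $ j $ j)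
     + (1 / 2) * (\<Sum>j\<in>UNIV. log_gradient q p C j x * log_gradient q p C j x)
     - (\<Sum>j\<in>UNIV. of_real (A t x $ j) * log_gradient q p C j x)
     + of_real (eff_potential A V t x)) * gaussian \<epsilon> q p C \<zeta> x"
proof -
  let ?g = "gaussian \<epsilon> q p C \<zeta>" and ?L = "log_gradient q p C"
  define a where "a j x = of_real (A t x $ j) - ?L j x" for j x
  have canc: "\<i> * of_real \<epsilon> * (\<i> / of_real \<epsilon> * z) = - z" for z
    using \<open>\<epsilon> > 0\<close> by simp
  have mom1: "momentum \<epsilon> A t j ?g = (\<lambda>x. a j x * ?g x)" for j
  proof
    fix x
    have "partial j ?g x = (\<i> / of_real \<epsilon> * ?L j x) * ?g x"
      using gaussian_partial[OF assms(2), of "\<lambda>_. 1" "\<lambda>_. 0" x j \<epsilon> q p \<zeta>] by simp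
    then show "momentum \<epsilon> A t j ?g x = a j x * ?g x"
      unfolding momentum_def mult.assoc[symmetric] using canc[of "?L j x"] \<open>\<epsilon> > 0\<close>
      by (simp add: a_def algebra_simps)
  qed
  have mom2: "momentum \<epsilon> A t j (momentum \<epsilon> A t j ?g) x =
      (\<i> * of_real \<epsilon> * (of_real (partial j (A t) x $ j) - C $ j $ j) + (a j x)\<^sup>2) * ?g x" for j
  proof -
    have DA: "(A t has_derivative (\<lambda>v. iter_deriv [v] (A t) x)) (at x)"
      using smooth_has_derivative[OF admissible_smooth(1)[OF adm], of "[]"] by simp
    have DL: "(?L j has_derivative (\<lambda>v. \<Sum>k\<in>UNIV. C $ j $ k * of_real (v $ k))) (at x)"
      unfolding log_gradient_def
      by (auto intro!: derivative_eq_intros bounded_linear.has_derivative[OF bounded_linear_vec_nth])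
    have "(a j has_derivative (\<lambda>v. of_real (iter_deriv [v] (A t) x $ j) -
        (\<Sum>k\<in>UNIV. C $ j $ k * of_real (v $ k)))) (at x)"
      unfolding a_def
      by (intro has_derivative_diff has_derivative_of_real DL
          bounded_linear.has_derivative[OF bounded_linear_vec_nth DA])
    note P = gaussian_partial[OF assms(2) this, of j \<epsilon> q p \<zeta>]
    have C: "(\<Sum>k\<in>UNIV. C $ j $ k * of_real (axis j 1 $ k)) = C $ j $ j"
      by (simp add: axis_def if_distrib[of "\<lambda>z. _ * of_real z"] if_distrib[of "\<lambda>z. _ * z"] cong: if_cong)
    have pA: "iter_deriv [axis j 1] (A t) x = partial j (A t) x"
      by (simp add: partial_def)
    have "momentum \<epsilon> A t j (momentum \<epsilon> A t j ?g) x =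
      (\<i> * of_real \<epsilon> * (of_real (partial j (A t) x $ j) - C $ j $ j)
       + a j x * (\<i> * of_real \<epsilon> * (\<i> / of_real \<epsilon> * ?L j x)) + of_real (A t x $ j) * a j x) * ?g x"
      unfolding mom1 momentum_def[of _ _ _ _ "\<lambda>x. a j x * ?g x"] P C pA
      by (simp only: distrib_left distrib_right mult_ac)
    also have "\<dots> = (\<i> * of_real \<epsilon> * (of_real (partial j (A t) x $ j) - C $ j $ j) + (a j x)\<^sup>2) * ?g x"
      unfolding canc by (simp add: a_def power2_eq_square algebra_simps)
    finally show ?thesis .
  qed
  have div: "(\<Sum>j\<in>UNIV. complex_of_real (partial j (A t) x $ j)) = 0"
    using adm unfolding admissible_potentials_def of_real_sum[symmetric] by simp
  have nA: "complex_of_real ((norm (A t x))\<^sup>2) = (\<Sum>j\<in>UNIV. (of_real (A t x $ j))\<^sup>2)"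
    unfolding power2_norm_eq_inner inner_vec_def by (simp add: power2_eq_square)
  have V: "complex_of_real (V t x) = of_real (eff_potential A V t x) - (1 / 2) * (\<Sum>j\<in>UNIV. (of_real (A t x $ j))\<^sup>2)"
    unfolding nA[symmetric] by (simp add: eff_potential_def)
  have mom: "(\<Sum>j\<in>UNIV. momentum \<epsilon> A t j (momentum \<epsilon> A t j ?g) x) =
     (\<i> * of_real \<epsilon> * ((\<Sum>j\<in>UNIV. of_real (partial j (A t) x $ j)) - (\<Sum>j\<in>UNIV. C $ j $ j))
       + (\<Sum>j\<in>UNIV. (a j x)\<^sup>2)) * ?g x"
    unfolding mom2 sum_distrib_right[symmetric]
    by (simp only: sum.distrib right_diff_distrib sum_subtractf sum_distrib_left)
  have a_sq: "(\<Sum>j\<in>UNIV. (a j x)\<^sup>2) = (\<Sum>j\<in>UNIV. (of_real (A t x $ j))\<^sup>2)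
      + (\<Sum>j\<in>UNIV. ?L j x * ?L j x) - 2 * (\<Sum>j\<in>UNIV. of_real (A t x $ j) * ?L j x)"
    unfolding sum_distrib_left sum.distrib[symmetric] sum_subtractf[symmetric] a_def
    by (intro sum.cong) (simp_all add: power2_eq_square algebra_simps)
  show ?thesis
    unfolding hamiltonian_def V mom a_sq div by (simp add: field_simps)
qed

section \<open>Quadratic approximation of the potentials on a Gaussian\<close>

lemma taylor1_affine: "(\<lambda>x. of_real (taylor1 f q x)) \<in> affine_polys"
proof -
  have "(\<lambda>x. of_real (f q) + (\<Sum>i\<in>UNIV. of_real (iter_deriv [axis i 1] f q) * of_real ((x - q) $ i))) \<in> affine_polys"
    by (intro affine_add affine_const affine_sum affine_scale affine_shifted_coord)
  then show ?thesis by (simp add: taylor1_def mult.commute)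
qed

lemma taylor2_quadratic: "(\<lambda>x. of_real (taylor2 f q x)) \<in> quadratic_polys"
proof -
  have "(\<lambda>x. of_real (taylor1 f q x) + (1 / 2) * (\<Sum>i\<in>UNIV. \<Sum>j\<in>UNIV.
      of_real (iter_deriv [axis j 1, axis i 1] f q) * (of_real ((x - q) $ i) * of_real ((x - q) $ j)))) \<in> quadratic_polys"
    by (intro quadratic_add quadratic_sum quadratic_scale affine_mult_quadratic affine_shifted_coord
        affine_quadratic taylor1_affine)
  then show ?thesis by (simp add: taylor2_def mult_ac del: iter_deriv.simps)
qed

text \<open>The squared phase gradient is already quadratic. In its product with \<open>A\<close>,
  the constant \<open>p\<close> admits the second-order Taylor polynomial of \<open>A\<close>, while
  \<open>C (x - q)\<close>, itself of first order, admits the first-order one; both errors are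
  cubic. The order of quantifiers makes \<open>K\<close> uniform in \<open>\<epsilon>\<close>, time
  and the parameters.\<close>

lemma hamiltonian_gaussian_cubic_remainder:
  fixes A :: "real \<Rightarrow> real^'n::finite \<Rightarrow> real^'n"
  assumes adm: "admissible_potentials A V"
  shows "\<exists>K. \<forall>\<epsilon> t q p C \<zeta>. \<epsilon> > 0 \<and> transpose C = C \<and> norm p \<le> M \<and> norm C \<le> M \<longrightarrow>
    (\<exists>\<phi>\<in>quadratic_polys. \<exists>R\<in>borel_measurable lborel. \<forall>x.
       hamiltonian \<epsilon> A V t (gaussian \<epsilon> q p C \<zeta>) x = (\<phi> x + R x) * gaussian \<epsilon> q p C \<zeta> x \<and>
       cmod (R x) \<le> K * norm (x - q) ^ 3)"
proof -
  let ?N = "real CARD('n)"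
  have bd: "spatial_deriv_bounded 2 A" "spatial_deriv_bounded 3 A"
      "spatial_deriv_bounded 3 (eff_potential A V)"
    using adm unfolding admissible_potentials_def by auto
  obtain B2 where
    B2: "\<And>t x vs. length vs = 2 \<Longrightarrow> set vs \<subseteq> Basis \<Longrightarrow> norm (iter_deriv vs (A t) x) \<le> B2"
    using bd(1) unfolding spatial_deriv_bounded_def by metis
  obtain B3 where
    B3: "\<And>t x vs. length vs = 3 \<Longrightarrow> set vs \<subseteq> Basis \<Longrightarrow> norm (iter_deriv vs (A t) x) \<le> B3"
    using bd(2) unfolding spatial_deriv_bounded_def by metis
  obtain BV where
    BV: "\<And>t x vs. length vs = 3 \<Longrightarrow> set vs \<subseteq> Basis \<Longrightarrow>
      norm (iter_deriv vs (eff_potential A V t) x) \<le> BV"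
    using bd(3) unfolding spatial_deriv_bounded_def by metis
  note sm = admissible_smooth[OF adm]
  have A1: "\<bar>A t x $ j - taylor1 (\<lambda>x. A t x $ j) q x\<bar> \<le> ?N ^ 2 * B2 * norm (x - q) ^ 2" for t x j q
  proof (rule taylor_bounds(1)[OF sm(3)])
    fix x :: "real^'n" and i k :: 'n
    have "\<bar>iter_deriv [axis k 1, axis i 1] (A t) x $ j\<bar> \<le> B2"
      by (rule order_trans[OF component_le_norm_cart B2]) auto
    then show "\<bar>iter_deriv [axis k 1, axis i 1] (\<lambda>x. A t x $ j) x\<bar> \<le> B2"
      by (simp only: iter_deriv_component[OF sm(1)])
  qed
  have A2: "\<bar>A t x $ j - taylor2 (\<lambda>x. A t x $ j) q x\<bar> \<le> ?N ^ 3 * B3 * norm (x - q) ^ 3" for t x j q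
  proof (rule taylor_bounds(2)[OF sm(3)])
    fix x :: "real^'n" and i k l :: 'n
    have "\<bar>iter_deriv [axis l 1, axis k 1, axis i 1] (A t) x $ j\<bar> \<le> B3"
      by (rule order_trans[OF component_le_norm_cart B3]) auto
    then show "\<bar>iter_deriv [axis l 1, axis k 1, axis i 1] (\<lambda>x. A t x $ j) x\<bar> \<le> B3"
      by (simp only: iter_deriv_component[OF sm(1)])
  qed
  have V2: "\<bar>eff_potential A V t x - taylor2 (eff_potential A V t) q x\<bar> \<le> ?N ^ 3 * BV * norm (x - q) ^ 3" for t x q
  proof (rule taylor_bounds(2)[OF sm(2)])
    fix x :: "real^'n" and i k l :: 'n
    show "\<bar>iter_deriv [axis l 1, axis k 1, axis i 1] (eff_potential A V t) x\<bar> \<le> BV"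
      using BV[of "[axis l 1, axis k 1, axis i 1]" t x] by simp
  qed
  \<comment> \<open>\<open>B3 * M\<close> is the second-order error of \<open>A\<close> against
    \<open>p\<close>, \<open>B2 * M\<close> the first-order error against \<open>C (x - q)\<close>,
    and \<open>BV\<close> the error of the effective potential; the leading factor counts the
    components of \<open>A\<close>.\<close>
  define K where "K = ?N * (?N ^ 3 * B3 * M + ?N ^ 3 * B2 * M) + ?N ^ 3 * BV"
  show ?thesis
  proof (intro exI[of _ K] allI impI)
    fix \<epsilon> t :: real and q p :: "real^'n" and C :: "complex^'n^'n" and \<zeta> :: complex
    assume hyp: "\<epsilon> > 0 \<and> transpose C = C \<and> norm p \<le> M \<and> norm C \<le> M"
    let ?L = "log_gradient q p C"
    define Cy where "Cy j x = (\<Sum>k\<in>UNIV. C $ j $ k * of_real ((x - q) $ k))" for j x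
    have L: "?L j x = Cy j x + of_real (p $ j)" for j x by (simp add: log_gradient_def Cy_def)
    have Cy_aff: "Cy j \<in> affine_polys" for j
      unfolding Cy_def by (intro affine_sum affine_scale affine_shifted_coord)
    define W where "W x = - \<i> * of_real \<epsilon> / 2 * (\<Sum>j\<in>UNIV. C $ j $ j)
       + (1 / 2) * (\<Sum>j\<in>UNIV. ?L j x * ?L j x)
       - (\<Sum>j\<in>UNIV. of_real (A t x $ j) * ?L j x) + of_real (eff_potential A V t x)" for x
    define \<phi> where "\<phi> x = - \<i> * of_real \<epsilon> / 2 * (\<Sum>j\<in>UNIV. C $ j $ j)
       + (1 / 2) * (\<Sum>j\<in>UNIV. ?L j x * ?L j x)
       + (- 1) * (\<Sum>j\<in>UNIV. of_real (p $ j) * of_real (taylor2 (\<lambda>x. A t x $ j) q x)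
            + of_real (taylor1 (\<lambda>x. A t x $ j) q x) * Cy j x)
       + of_real (taylor2 (eff_potential A V t) q x)" for x
    define R where "R x = W x - \<phi> x" for x
    have \<phi>: "\<phi> \<in> quadratic_polys"
      unfolding \<phi>_def
      by (intro quadratic_add quadratic_const quadratic_scale quadratic_sum affine_mult_quadratic
          affine_log_gradient taylor2_quadratic taylor1_affine Cy_aff)
    have "W \<in> borel_measurable lborel"
      unfolding W_def
      using smooth_measurable[OF sm(2)] smooth_measurable[OF sm(3)]
        polyfuns_measurable[OF affine_polyfuns[OF affine_log_gradient]]
      by (intro borel_measurable_add borel_measurable_diff borel_measurable_times
          borel_measurable_sum borel_measurable_of_real borel_measurable_const) auto
    then have "R \<in> borel_measurable lborel"
      unfolding R_def using polyfuns_measurable[OF quadratic_polyfuns[OF \<phi>]] by simp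
    moreover have "hamiltonian \<epsilon> A V t (gaussian \<epsilon> q p C \<zeta>) x = (\<phi> x + R x) * gaussian \<epsilon> q p C \<zeta> x" for x
      using hamiltonian_gaussian[OF adm, of C \<epsilon>] hyp by (simp add: R_def W_def)
    moreover have "cmod (R x) \<le> K * norm (x - q) ^ 3" for x
    proof -
      let ?y = "norm (x - q)"
      define r1 where "r1 j = A t x $ j - taylor1 (\<lambda>x. A t x $ j) q x" for j
      define r2 where "r2 j = A t x $ j - taylor2 (\<lambda>x. A t x $ j) q x" for j
      define rV where "rV = eff_potential A V t x - taylor2 (eff_potential A V t) q x"
      have R: "R x = - (\<Sum>j\<in>UNIV. of_real (r2 j) * of_real (p $ j) + of_real (r1 j) * Cy j x) + of_real rV"
      proof -
        have "(\<Sum>j\<in>UNIV. of_real (A t x $ j) * ?L j x) =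
          (\<Sum>j\<in>UNIV. of_real (p $ j) * of_real (taylor2 (\<lambda>x. A t x $ j) q x)
            + of_real (taylor1 (\<lambda>x. A t x $ j) q x) * Cy j x) +
          (\<Sum>j\<in>UNIV. of_real (r2 j) * of_real (p $ j) + of_real (r1 j) * Cy j x)"
          unfolding sum.distrib[symmetric]
          by (intro sum.cong refl) (simp add: L r1_def r2_def algebra_simps)
        then show ?thesis by (simp add: R_def W_def \<phi>_def rV_def)
      qed
      have Cy_le: "cmod (Cy j x) \<le> ?N * M * ?y" for j
      proof -
        have "cmod (C $ j $ k * of_real ((x - q) $ k)) \<le> M * ?y" for k
        proof -
          have "cmod (C $ j $ k) \<le> M"
            using hyp Finite_Cartesian_Product.norm_nth_le[of "C $ j" k] Finite_Cartesian_Product.norm_nth_le[of C j] by linarith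
          then show ?thesis
            unfolding norm_mult norm_of_real
            by (intro mult_mono component_le_norm_cart) (auto intro: order_trans[OF norm_ge_zero])
        qed
        then have "cmod (Cy j x) \<le> (\<Sum>k\<in>(UNIV::'n set). M * ?y)"
          unfolding Cy_def by (intro order_trans[OF norm_sum] sum_mono)
        then show ?thesis by simp
      qed
      have pj: "\<bar>p $ j\<bar> \<le> M" for j
        using hyp component_le_norm_cart[of p j] by linarith
      have summand: "cmod (of_real (r2 j) * of_real (p $ j) + of_real (r1 j) * Cy j x) \<le>
          (?N ^ 3 * B3 * M + ?N ^ 3 * B2 * M) * ?y ^ 3" for j
      proof -
        have "cmod (of_real (r2 j) * of_real (p $ j)) \<le> (?N ^ 3 * B3 * ?y ^ 3) * M"
          unfolding norm_mult norm_of_real r2_def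
          by (intro mult_mono A2 pj) (auto intro: order_trans[OF abs_ge_zero A2])
        moreover have "cmod (of_real (r1 j) * Cy j x) \<le> (?N ^ 2 * B2 * ?y ^ 2) * (?N * M * ?y)"
          unfolding norm_mult norm_of_real r1_def
          by (intro mult_mono A1 Cy_le) (auto intro: order_trans[OF abs_ge_zero A1])
        ultimately show ?thesis
          using norm_triangle_ineq[of "of_real (r2 j) * of_real (p $ j)" "of_real (r1 j) * Cy j x"]
          by (simp add: power2_eq_square power3_eq_cube algebra_simps)
      qed
      have "cmod (R x) \<le> (\<Sum>j\<in>(UNIV::'n set). (?N ^ 3 * B3 * M + ?N ^ 3 * B2 * M) * ?y ^ 3) + ?N ^ 3 * BV * ?y ^ 3"
        unfolding R
      proof (intro order_trans[OF norm_triangle_ineq] add_mono)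
        show "cmod (- (\<Sum>j\<in>UNIV. of_real (r2 j) * of_real (p $ j) + of_real (r1 j) * Cy j x)) \<le>
          (\<Sum>j\<in>(UNIV::'n set). (?N ^ 3 * B3 * M + ?N ^ 3 * B2 * M) * ?y ^ 3)"
          unfolding norm_minus_cancel by (intro order_trans[OF norm_sum] sum_mono summand)
        show "cmod (of_real rV) \<le> ?N ^ 3 * BV * ?y ^ 3"
          unfolding rV_def norm_of_real by (rule V2)
      qed
      then show ?thesis by (simp add: K_def algebra_simps)
    qed
    ultimately show "\<exists>\<phi>\<in>quadratic_polys. \<exists>R\<in>borel_measurable lborel. \<forall>x.
       hamiltonian \<epsilon> A V t (gaussian \<epsilon> q p C \<zeta>) x = (\<phi> x + R x) * gaussian \<epsilon> q p C \<zeta> x \<and>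
       cmod (R x) \<le> K * norm (x - q) ^ 3"
      using \<phi> by blast
  qed
qed

section \<open>Error bound\<close>

lemma has_L2_derivative_subset:
  "has_L2_derivative w dw t S \<Longrightarrow> S' \<subseteq> S \<Longrightarrow> has_L2_derivative w dw t S'"
  unfolding has_L2_derivative_def by (auto intro: tendsto_within_subset)

text \<open>The square of the cubic remainder meets the weight of \<open>gaussian_weight_L2\<close>.
  With \<open>z\<close> the exponent, \<open>y^2\<close> is \<open>2 \<epsilon> z / \<rho>\<close>,
  and cubing \<open>z / 3 \<le> exp (z / 3)\<close> gives \<open>z^3 \<le> 27 exp z\<close>; thus
  216 = 8 * 27.\<close>

lemma sixth_power_le_exp:
  fixes y :: real
  assumes "\<epsilon> > 0" "\<rho> > 0"
  shows "y ^ 6 \<le> 216 * \<epsilon> ^ 3 / \<rho> ^ 3 * exp (\<rho> * y\<^sup>2 / (2 * \<epsilon>))"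
proof -
  define z where "z = \<rho> * y\<^sup>2 / (2 * \<epsilon>)"
  have "z \<ge> 0" using assms by (simp add: z_def)
  have "(z / 3) ^ 3 \<le> exp (z / 3) ^ 3"
    using \<open>z \<ge> 0\<close> exp_ge_add_one_self[of "z / 3"] by (intro power_mono) linarith+
  also have "\<dots> = exp z" by (simp flip: exp_of_nat_mult)
  finally have "z ^ 3 \<le> 27 * exp z" by (simp add: power_divide)
  have y2: "y\<^sup>2 = 2 * \<epsilon> / \<rho> * z" using assms by (simp add: z_def)
  have "y ^ 6 = (y\<^sup>2) ^ 3" by (simp flip: power_mult)
  also have "\<dots> = 8 * \<epsilon> ^ 3 / \<rho> ^ 3 * z ^ 3"
    unfolding y2 by (simp add: power_mult_distrib power_divide)
  also have "\<dots> \<le> 8 * \<epsilon> ^ 3 / \<rho> ^ 3 * (27 * exp z)"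
    using assms \<open>z ^ 3 \<le> 27 * exp z\<close> by (intro mult_left_mono) auto
  finally show ?thesis unfolding z_def by simp
qed

theorem theorem3p8:
  fixes A :: "real \<Rightarrow> real^'n::finite \<Rightarrow> real^'n"
    and V :: "real \<Rightarrow> real^'n \<Rightarrow> real"
    and \<rho> M :: real
  assumes "admissible_potentials A V"
    and "\<rho> > 0"
  shows "\<exists>c::real. \<forall>(\<epsilon>::real) (T::real) U \<psi> u0 u
           (q :: real \<Rightarrow> real^'n) (p :: real \<Rightarrow> real^'n)
           (C :: real \<Rightarrow> complex^'n^'n) (\<zeta> :: real \<Rightarrow> complex).
           0 < \<epsilon> \<and> \<epsilon> \<le> 1 \<and> 0 < T \<and>
           u0 \<in> wave_packets \<epsilon> \<and> L2_norm u0 = 1 \<and>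
           unitary_evolution_family U \<and> generated_by_hamiltonian \<epsilon> A V U \<and>
           (\<forall>t\<in>{0..T}. AE x in lborel. \<psi> t x = U t 0 u0 x) \<and>
           (\<forall>t\<in>{0..T}. \<psi> t \<in> L2) \<and>
           variational_solution \<epsilon> A V T u0 u \<and>
           (\<forall>t\<in>{0..T}. width_matrix (C t) \<and> u t = gaussian \<epsilon> (q t) (p t) (C t) (\<zeta> t)) \<and>
           (\<forall>t\<in>{0..T}. norm (q t) \<le> M \<and> norm (p t) \<le> M \<and> norm (C t) \<le> M \<and> norm (\<zeta> t) \<le> M) \<and>
           (\<forall>t\<in>{0..T}. \<forall>l. real_eigenvalue (Im_matrix (C t)) l \<longrightarrow> \<rho> \<le> l)
           \<longrightarrow> (\<forall>t\<in>{0..T}. L2_norm (\<lambda>x. \<psi> t x - u t x) \<le> t * c * sqrt \<epsilon>)"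
proof -
  obtain K where K: "\<forall>\<epsilon> t q p C \<zeta>. \<epsilon> > 0 \<and> transpose C = C \<and> norm p \<le> M \<and> norm C \<le> M \<longrightarrow>
    (\<exists>\<phi>\<in>quadratic_polys. \<exists>R\<in>borel_measurable lborel. \<forall>x.
       hamiltonian \<epsilon> A V t (gaussian \<epsilon> q p C \<zeta>) x = (\<phi> x + R x) * gaussian \<epsilon> q p C \<zeta> x \<and>
       cmod (R x) \<le> K * norm (x - q) ^ 3)"
    using hamiltonian_gaussian_cubic_remainder[OF assms(1), of M] by (rule exE)
  \<comment> \<open>The root combines the constant of \<open>sixth_power_le_exp\<close> with the
    Jacobian of the dilation. The absolute value secures \<open>c \<ge> 0\<close>, as no sign of
    \<open>K\<close> is given.\<close>
  define c where "c = \<bar>K\<bar> * sqrt (216 / \<rho> ^ 3 * sqrt 2 ^ CARD('n))"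
  show ?thesis
  proof (intro exI[of _ c] allI impI ballI)
    fix \<epsilon> T :: real and U \<psi> u0 u q p C \<zeta> \<tau>
    assume H: "0 < \<epsilon> \<and> \<epsilon> \<le> 1 \<and> 0 < T \<and>
           u0 \<in> wave_packets \<epsilon> \<and> L2_norm u0 = 1 \<and>
           unitary_evolution_family U \<and> generated_by_hamiltonian \<epsilon> A V U \<and>
           (\<forall>t\<in>{0..T}. AE x in lborel. \<psi> t x = U t 0 u0 x) \<and>
           (\<forall>t\<in>{0..T}. \<psi> t \<in> L2) \<and>
           variational_solution \<epsilon> A V T u0 u \<and>
           (\<forall>t\<in>{0..T}. width_matrix (C t) \<and> u t = gaussian \<epsilon> (q t) (p t) (C t) (\<zeta> t)) \<and>
           (\<forall>t\<in>{0..T}. norm (q t) \<le> M \<and> norm (p t) \<le> M \<and> norm (C t) \<le> M \<and> norm (\<zeta> t) \<le> M) \<and>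
           (\<forall>t\<in>{0..T}. \<forall>l. real_eigenvalue (Im_matrix (C t)) l \<longrightarrow> \<rho> \<le> l)"
      and \<tau>: "\<tau> \<in> {0..T}"
    then have \<epsilon>: "\<epsilon> > 0" and u0: "L2_norm u0 = 1"
      and U: "unitary_evolution_family U" and gen: "generated_by_hamiltonian \<epsilon> A V U"
      and \<psi>: "AE x in lborel. \<psi> \<tau> x = U \<tau> 0 u0 x" "\<psi> \<tau> \<in> L2"
      and var: "variational_solution \<epsilon> A V T u0 u"
      by auto
    have unit: "L2_unitary (U \<tau> s)" for s
      using U by (simp add: unitary_evolution_family_def)
    let ?H = "\<lambda>s. hamiltonian \<epsilon> A V s (u s)"
    let ?P = "\<lambda>s. L2_proj (tangent_space (u s)) (?H s)"
    have "\<forall>s\<in>{0..T}. \<exists>du. has_L2_derivative u du s {0..T} \<and>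
        (AE x in lborel. \<i> * of_real \<epsilon> * du x = ?P s x)"
      using var by (simp add: variational_solution_def)
    then obtain du where du: "\<And>s. s \<in> {0..T} \<Longrightarrow> has_L2_derivative u (du s) s {0..T}"
      and du_eq: "\<And>s. s \<in> {0..T} \<Longrightarrow> AE x in lborel. \<i> * of_real \<epsilon> * du s x = ?P s x"
      by metis
    define r where "r s = (\<lambda>x. du s x + \<i> / of_real \<epsilon> * ?H s x)" for s
    define w where "w s = U \<tau> s (u s)" for s
    have uL: "u s \<in> L2" and duL: "du s \<in> L2" if "s \<in> {0..T}" for s
      using du[OF that] that by (auto simp: has_L2_derivative_def)
    have main: "has_L2_derivative w (U \<tau> s (r s)) s {0..T} \<and> r s \<in> L2 \<and>
        L2_inner (u s) (r s) = 0 \<and> L2_norm (r s) \<le> c * sqrt \<epsilon> * L2_norm (u s)"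
      if s: "s \<in> {0..T}" for s
    proof -
      have u_eq: "u s = gaussian \<epsilon> (q s) (p s) (C s) (\<zeta> s)"
        and sym: "transpose (C s) = C s" and bd: "norm (p s) \<le> M" "norm (C s) \<le> M"
        and ev: "\<And>l. real_eigenvalue (Im_matrix (C s)) l \<Longrightarrow> \<rho> \<le> l"
        using H s by (auto simp: width_matrix_def)
      have "transpose (Im_matrix (C s)) = Im_matrix (C s)"
        using arg_cong[OF sym, of Im_matrix] by (simp add: Im_matrix_def transpose_def vec_eq_iff)
      then have ray: "\<rho> * (norm y)\<^sup>2 \<le> y \<bullet> (Im_matrix (C s) *v y)" for y
        using symmetric_eigenvalue_lower_bound ev by blast
      have schw: "schwartz (u s)"
        unfolding u_eq by (rule schwartz_gaussian[OF sym \<epsilon> assms(2) ray])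
      have gL: "gaussian \<epsilon> (q s) (p s) (C s) (\<zeta> s) \<in> L2" using uL[OF s] by (simp add: u_eq)
      have poly_L2: "(\<lambda>x. f x * u s x) \<in> L2" if "f \<in> quadratic_polys" for f
        unfolding u_eq
        by (rule subgaussian_gaussian_L2[OF \<epsilon> assms(2) gL ray
              polyfuns_measurable[OF quadratic_polyfuns[OF that]]
              polyfuns_subgaussian_growth[OF quadratic_polyfuns[OF that]]])
      have tan_L2: "tangent_space (u s) \<subseteq> L2"
        by (auto simp: tangent_space_def poly_L2)
      obtain \<phi> R where \<phi>: "\<phi> \<in> quadratic_polys" and Rm: "R \<in> borel_measurable lborel"
        and Hs: "\<And>x. ?H s x = (\<phi> x + R x) * u s x"
        and R: "\<And>x. cmod (R x) \<le> K * norm (x - q s) ^ 3"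
        using K[rule_format, of \<epsilon> "C s" "p s" s "q s" "\<zeta> s"] \<epsilon> sym bd unfolding u_eq by blast
      define B where "B = K\<^sup>2 * (216 * \<epsilon> ^ 3 / \<rho> ^ 3)"
      have R_sq: "(cmod (R x))\<^sup>2 \<le> B * exp (\<rho> * (norm (x - q s))\<^sup>2 / (2 * \<epsilon>))" for x
      proof -
        have "(cmod (R x))\<^sup>2 \<le> (K * norm (x - q s) ^ 3)\<^sup>2"
          using R[of x] by (intro power_mono) auto
        also have "\<dots> = K\<^sup>2 * norm (x - q s) ^ 6"
          by (simp add: power_mult_distrib flip: power_mult)
        also have "\<dots> \<le> K\<^sup>2 * (216 * \<epsilon> ^ 3 / \<rho> ^ 3 * exp (\<rho> * (norm (x - q s))\<^sup>2 / (2 * \<epsilon>)))"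
          by (intro mult_left_mono sixth_power_le_exp \<epsilon> assms(2)) auto
        finally show ?thesis by (simp add: B_def)
      qed
      note R_weight = gaussian_weight_L2[OF \<epsilon> gL ray Rm R_sq, folded u_eq]
      have HL: "?H s \<in> L2"
      proof -
        have "?H s = (\<lambda>x. \<phi> x * u s x + R x * u s x)"
          by (rule ext) (simp only: Hs distrib_right)
        then show ?thesis using L2_add[OF poly_L2[OF \<phi>] R_weight(1)] by simp
      qed
      note P = tangent_space_projection[OF tan_L2 HL]
      have PL: "?P s \<in> L2" using P(1) tan_L2 by blast
      have \<phi>_tan: "(\<lambda>x. \<phi> x * u s x) \<in> tangent_space (u s)"
        using \<phi> by (auto simp: tangent_space_def)
      \<comment> \<open>The constant polynomial 1 puts \<open>u\<close> into its own tangent space,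
        whence the orthogonality of the defect to \<open>u\<close>.\<close>
      have u_tan: "u s \<in> tangent_space (u s)"
        using quadratic_const[of 1] by (auto simp: tangent_space_def intro!: exI[of _ "\<lambda>x. 1"])
      have rL: "r s \<in> L2" unfolding r_def by (intro L2_add L2_scale duL[OF s] HL)
      have DL: "(\<lambda>x. ?H s x - ?P s x) \<in> L2" by (intro L2_diff HL PL)
      have r_eq: "AE x in lborel. r s x = \<i> / of_real \<epsilon> * (?H s x - ?P s x)"
        using du_eq[OF s]
      proof eventually_elim
        case (elim x)
        have "du s x = - \<i> / of_real \<epsilon> * (\<i> * of_real \<epsilon> * du s x)"
          using \<epsilon> by (simp add: field_simps)
        then show ?case unfolding elim r_def by (simp add: algebra_simps)
      qed
      have "L2_inner (u s) (r s) = L2_inner (u s) (\<lambda>x. \<i> / of_real \<epsilon> * (?H s x - ?P s x))"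
        by (intro L2_inner_cong_AE r_eq uL s rL L2_scale DL)
      also have "\<dots> = 0" unfolding L2_inner_scale_right P(2)[OF u_tan] by simp
      finally have orth: "L2_inner (u s) (r s) = 0" .
      have "L2_norm (r s) = L2_norm (\<lambda>x. \<i> / of_real \<epsilon> * (?H s x - ?P s x))"
        by (intro L2_norm_cong_AE r_eq rL L2_scale DL)
      also have "\<dots> = 1 / \<epsilon> * L2_norm (\<lambda>x. ?H s x - ?P s x)"
        unfolding L2_norm_scale using \<epsilon> by (simp add: norm_divide)
      also have "\<dots> \<le> 1 / \<epsilon> * L2_norm (\<lambda>x. R x * u s x)"
      proof (intro mult_left_mono)
        have "L2_norm (\<lambda>x. ?H s x - ?P s x) \<le> L2_norm (\<lambda>x. ?H s x - \<phi> x * u s x)"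
          by (rule L2_proj_best_approx[OF P(1) P(2) \<phi>_tan tan_L2 HL])
        then show "L2_norm (\<lambda>x. ?H s x - ?P s x) \<le> L2_norm (\<lambda>x. R x * u s x)"
          by (simp add: Hs distrib_right)
      qed (use \<epsilon> in auto)
      \<comment> \<open>The root of the \<open>\<epsilon> ^ 3\<close> in \<open>B\<close> is
        \<open>\<epsilon> * sqrt \<epsilon>\<close>; its first factor cancels the prefactor.\<close>
      also have "\<dots> \<le> 1 / \<epsilon> * (c * \<epsilon> * sqrt \<epsilon> * L2_norm (u s))"
      proof (rule mult_left_mono, rule power2_le_imp_le)
        have "(c * \<epsilon> * sqrt \<epsilon> * L2_norm (u s))\<^sup>2 = B * sqrt 2 ^ CARD('n) * (L2_norm (u s))\<^sup>2"
        proof -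
          have "c\<^sup>2 = K\<^sup>2 * (216 / \<rho> ^ 3 * sqrt 2 ^ CARD('n))"
            unfolding c_def power_mult_distrib power2_abs
            using assms(2) by (subst real_sqrt_pow2) auto
          moreover have "(sqrt \<epsilon>)\<^sup>2 = \<epsilon>" using \<epsilon> by (intro real_sqrt_pow2) auto
          moreover have "\<epsilon>\<^sup>2 * \<epsilon> = \<epsilon> ^ 3" by (simp add: power2_eq_square power3_eq_cube)
          ultimately show ?thesis
            unfolding B_def power_mult_distrib by (simp add: mult_ac)
        qed
        then show "(L2_norm (\<lambda>x. R x * u s x))\<^sup>2 \<le> (c * \<epsilon> * sqrt \<epsilon> * L2_norm (u s))\<^sup>2"
          using R_weight(2) by simp
      qed (use \<epsilon> assms(2) in \<open>auto simp: c_def\<close>)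
      also have "\<dots> = c * sqrt \<epsilon> * L2_norm (u s)" using \<epsilon> by simp
      finally have "L2_norm (r s) \<le> c * sqrt \<epsilon> * L2_norm (u s)" .
      moreover have "has_L2_derivative w (U \<tau> s (r s)) s {0..T}"
        unfolding w_def r_def by (rule evolution_derivative[OF U gen schw du[OF s] s HL \<epsilon>])
      ultimately show ?thesis using rL orth by blast
    qed
    have sub: "s \<in> {0..T}" if "s \<in> {0..\<tau>}" for s using that \<tau> by auto
    \<comment> \<open>Restricting to \<open>{0..\<tau>}\<close> makes the bound proportional to
      \<open>\<tau>\<close> instead of \<open>T\<close>.\<close>
    have der: "has_L2_derivative w (U \<tau> s (r s)) s {0..\<tau>}" if "s \<in> {0..\<tau>}" for s
      using main[OF sub[OF that]] \<tau> by (auto intro: has_L2_derivative_subset)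
    have nw: "L2_norm (w s) = L2_norm (u s)" if "s \<in> {0..\<tau>}" for s
      unfolding w_def by (rule L2_unitary_norm[OF unit uL[OF sub[OF that]]])
    have u_init: "u 0 = u0" using var by (simp add: variational_solution_def)
    \<comment> \<open>Unitarity turns the inner product of \<open>w\<close> with its derivative into
      that of \<open>u\<close> with \<open>r\<close>, which is 0; the norm then passes back from
      \<open>w\<close> to \<open>u\<close>.\<close>
    have norm1: "L2_norm (u s) = 1" if s: "s \<in> {0..\<tau>}" for s
    proof -
      have "L2_norm (w s) = L2_norm (w 0)"
      proof (rule L2_norm_constant[OF s der])
        fix s assume "s \<in> {0..\<tau>}"
        then show "Re (L2_inner (w s) (U \<tau> s (r s))) = 0"
          using main[OF sub] uL[OF sub] unit unfolding w_def by (simp add: L2_unitary_inner)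
      qed
      then show ?thesis using nw[OF s] nw[of 0] \<tau> u0 u_init by simp
    qed
    have mv: "L2_norm (\<lambda>x. w \<tau> x - w 0 x) \<le> (\<tau> - 0) * (c * sqrt \<epsilon>)"
    proof (rule L2_mean_value[OF _ der])
      fix s assume s: "s \<in> {0..\<tau>}"
      have "L2_norm (U \<tau> s (r s)) = L2_norm (r s)"
        using main[OF sub[OF s]] unit by (intro L2_unitary_norm) auto
      also have "\<dots> \<le> c * sqrt \<epsilon>"
        using main[OF sub[OF s]] norm1[OF s] by simp
      finally show "L2_norm (U \<tau> s (r s)) \<le> c * sqrt \<epsilon>" .
    qed (use \<tau> in auto)
    have wL: "w s \<in> L2" if "s \<in> {0..\<tau>}" for s
      unfolding w_def by (rule L2_unitary_L2[OF unit uL[OF sub[OF that]]])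
    have "AE x in lborel. w \<tau> x = u \<tau> x"
      using U uL[OF \<tau>] unfolding unitary_evolution_family_def w_def by blast
    \<comment> \<open>The curve \<open>w\<close> runs from \<open>\<psi> \<tau>\<close> to
      \<open>u \<tau>\<close>, so its increment has the opposite sign; the factor -1 has modulus 1
      in \<open>L2_norm_scale\<close>.\<close>
    with \<psi>(1) have "AE x in lborel. \<psi> \<tau> x - u \<tau> x = - 1 * (w \<tau> x - w 0 x)"
    proof eventually_elim
      case (elim x)
      have "w 0 x = \<psi> \<tau> x" unfolding w_def u_init elim(1) ..
      with elim(2) show ?case by simp
    qed
    then have "L2_norm (\<lambda>x. \<psi> \<tau> x - u \<tau> x) = L2_norm (\<lambda>x. - 1 * (w \<tau> x - w 0 x))"
      using \<tau> by (intro L2_norm_cong_AE L2_diff L2_scale \<psi>(2) uL wL) auto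
    also have "\<dots> = L2_norm (\<lambda>x. w \<tau> x - w 0 x)"
      unfolding L2_norm_scale by simp
    finally show "L2_norm (\<lambda>x. \<psi> \<tau> x - u \<tau> x) \<le> \<tau> * c * sqrt \<epsilon>"
      using mv by (simp add: mult.assoc)
  qed
qed

end
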